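(* Let $\alpha,\beta,\sigma$, $\eta=\alpha\beta$, $(s_n)_{n\ge0}$, $\mu_{\alpha,\beta,\sigma}$, $X_{\alpha,\beta}$, $\mathcal D_{\alpha,\beta,\sigma}$, $\mathcal F_{\alpha,\beta,\sigma}$ and the unitary operator $\mathcal S:L^2(X_{\alpha,\beta},\mu_{\alpha,\beta,\sigma})\to\mathcal F_{\alpha,\beta,\sigma}$, $(\mathcal Ss_n)(z)=(z\mid\beta)_n$, be as in the context. Define $$\mathcal E(x,z)=\sum_{n=0}^\infty\frac{(z\mid\beta)_n}{n!\,(\sigma\mid-\eta)_n}\,s_n(x),\qquad x\in X_{\alpha,\beta},\ z\in\mathcal D_{\alpha,\beta,\sigma}$$ (series in $L^2(X_{\alpha,\beta},\mu_{\alpha,\beta,\sigma})$ as a function of $x$). Then for each $z\in\mathcal D_{\alpha,\beta,\sigma}$ we have $\mathcal E(\cdot,z)\in L^2(X_{\alpha,\beta},\mu_{\alpha,\beta,\sigma})$ and $$(\mathcal Sf)(z)=\int_{X_{\alpha,\beta}}f(x)\,\mathcal E(x,z)\,\mu_{\alpha,\beta,\sigma}(dx),\qquad f\in L^2(X_{\alpha,\beta},\mu_{\alpha,\beta,\sigma}).$$ Furthermore, if $\alpha=\beta>0$, $$\mathcal E(x,z)=\frac{\Gamma\big(\frac\sigma{\alpha^2}\big)}{\Gamma\big(\frac{\alpha z+\sigma}{\alpha^2}\big)}\Big(\frac x\alpha\Big)^{\frac z\alpha},\qquad x\in(0,\infty),\ z\in\mathcal D_{\alpha,\alpha,\sigma};$$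 if $\alpha>\beta>0$, $$\mathcal E((\alpha-\beta)n,z)=\Big(1-\frac\beta\alpha\Big)^{\frac z\beta}\frac{(\alpha z+\sigma\mid-\eta)_n}{(\sigma\mid-\eta)_n},\qquad n\in\mathbb N_0,\ z\in\mathbb C;$$ and if $\Re(\alpha)\ge0$, $\Im(\alpha)>0$, $\beta=\overline\alpha$, $$\mathcal E(x,z)=\Big(2\cos\big(\tfrac\pi2-\operatorname{Arg}(\alpha)\big)\Big)^{\frac{\alpha z}\eta}\frac{\Gamma(\frac\sigma\eta)}{\Gamma(\frac{\sigma+\alpha z}\eta)}\exp\Big(\frac{i(\frac\pi2-\operatorname{Arg}(\alpha))\alpha z}{\eta}\Big)\frac{\Gamma\big(-\frac{ix}{2\Im(\alpha)}-\frac{i\sigma\alpha}{2\eta\Im(\alpha)}+\frac{\alpha z}\eta\big)}{\Gamma\big(-\frac{ix}{2\Im(\alpha)}-\frac{i\sigma\alpha}{2\eta\Im(\alpha)}\big)},\quad x\in\mathbb R,\ z\in\mathcal D_{\alpha,\beta,\sigma}.$$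
   Context: $\mathbb N_0=\{0,1,2,\dots\}$; $(z\mid h)_0=1$, $(z\mid h)_n=z(z-h)\cdots(z-(n-1)h)$; $(z)^{(n)}=(z\mid-1)_n$. Parameters: $\sigma>0$, and $\alpha,\beta\in\mathbb C$ satisfy one of: $\alpha=\beta>0$; $\alpha>\beta>0$; $\Re(\alpha)\ge0$, $\Im(\alpha)>0$, $\beta=\overline\alpha$. Put $\lambda=\alpha+\beta$, $\eta=\alpha\beta>0$, $l=\sigma/\alpha$ in the first two cases, $l=0$ in the third. $(s_n)$ is the monic polynomial sequence with $s_0=1$, $xs_n(x)=s_{n+1}(x)+(\lambda n+l)s_n(x)+(\sigma n+\eta n(n-1))s_{n-1}(x)$, orthogonal with $\|s_n\|^2=n!\,(\sigma\mid-\eta)_n$ with respect to the probability measure $\mu_{\alpha,\beta,\sigma}$ on $X_{\alpha,\beta}$: - $\alpha=\beta>0$: $X_{\alpha,\beta}=(0,\infty)$, $\mu_{\alpha,\alpha,\sigma}(dx)=\frac1{\Gamma(\sigma/\eta)}\alpha^{-\sigma/\eta}x^{-1+\sigma/\eta}e^{-x/\alpha}dx$; - $\alpha>\beta>0$: $X_{\alpha,\beta}=(\alpha-\beta)\mathbb N_0$, $\mu_{\alpha,\beta,\sigma}=(1-\frac\beta\alpha)^{\sigma/\eta}\sum_{n\ge0}(\frac\beta\alpha)^n\frac1{n!}(\frac\sigma\eta)^{(n)}\delta_{(\alpha-\beta)n}$; - third case: $X_{\alpha,\beta}=\mathbb R$, $\mu_{\alpha,\beta,\sigma}(dx)=C_{\alpha,\beta,\sigma}\exp\big((\frac\pi2-\operatorname{Arg}(\alpha))x/\Im(\alpha)\big)\big|\Gamma\big(\frac{ix}{2\Im(\alpha)}+\frac{i\sigma\beta}{2\eta\Im(\alpha)}\big)\big|^2dx$,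 $\operatorname{Arg}(\alpha)\in(0,\pi/2]$, $C_{\alpha,\beta,\sigma}=\frac{(2\cos(\frac\pi2-\operatorname{Arg}(\alpha)))^{\sigma/\eta}}{4\Im(\alpha)\pi\Gamma(\sigma/\eta)}\exp\big(\frac{(\frac\pi2-\operatorname{Arg}(\alpha))\sigma\Re(\alpha)}{\Im(\alpha)\eta}\big)$. $\mathcal D_{\alpha,\beta,\sigma}=\{z\in\mathbb C\mid\Re(\alpha z)>-\sigma/2\}$ if $|\alpha|=|\beta|$ (first and third cases), $\mathcal D_{\alpha,\beta,\sigma}=\mathbb C$ if $\alpha>\beta>0$. $\mathcal F_{\alpha,\beta,\sigma}$ is the Hilbert space of holomorphic functions on $\mathcal D_{\alpha,\beta,\sigma}$ of the form $\varphi(z)=\sum_nf_n(z\mid\beta)_n$ with $\|\varphi\|^2=\sum_n|f_n|^2n!\,(\sigma\mid-\eta)_n<\infty$ (such series converge locally uniformly on $\mathcal D_{\alpha,\beta,\sigma}$ and the $f_n$ are unique), inner product $\sum_nf_n\overline{g_n}\,n!\,(\sigma\mid-\eta)_n$. $\mathcal S$ is the unitary operator with $(\mathcal Ss_n)(z)=(z\mid\beta)_n$ for all $n\in\mathbb N_0$. Powers of positive reals with complex exponent are the principal ones. The explicit formulas identify $\mathcal E(\cdot,z)$ as an element of $L^2$. *)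

theory Defs
  imports "HOL-Analysis.Analysis"
begin

text \<open>
  Elements of the space \<open>L\<^sup>2\<close> are represented by functions; equality in \<open>L\<^sup>2\<close> is equality almost
  everywhere.
\<close>

definition L2 :: "'a measure \<Rightarrow> ('a \<Rightarrow> complex) set" where
  "L2 M = {f. f \<in> borel_measurable M \<and> integrable M (\<lambda>x. (cmod (f x))\<^sup>2)}"

definition L2_inner :: "'a measure \<Rightarrow> ('a \<Rightarrow> complex) \<Rightarrow> ('a \<Rightarrow> complex) \<Rightarrow> complex" where
  "L2_inner M f g = (\<integral>x. f x * cnj (g x) \<partial>M)"

definition L2_sums :: "'a measure \<Rightarrow> (nat \<Rightarrow> 'a \<Rightarrow> complex) \<Rightarrow> ('a \<Rightarrow> complex) \<Rightarrow> bool" where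
  "L2_sums M u g \<longleftrightarrow> (\<forall>n. u n \<in> L2 M) \<and> g \<in> L2 M \<and>
     (\<lambda>N. \<integral>x. (cmod (g x - (\<Sum>n<N. u n x)))\<^sup>2 \<partial>M) \<longlonglongrightarrow> 0"

text \<open>The generalized factorial \<open>(z | h)\<^sub>n = z (z - h) \<dots> (z - (n - 1) h)\<close>.\<close>

definition gen_fact :: "'a::comm_ring_1 \<Rightarrow> 'a \<Rightarrow> nat \<Rightarrow> 'a" where
  "gen_fact z h n = (\<Prod>i<n. z - of_nat i * h)"

definition gamma_case :: "complex \<Rightarrow> complex \<Rightarrow> bool" where
  "gamma_case \<alpha> \<beta> \<longleftrightarrow> \<alpha> = \<beta> \<and> Im \<alpha> = 0 \<and> Re \<alpha> > 0"

definition neg_binomial_case :: "complex \<Rightarrow> complex \<Rightarrow> bool" where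
  "neg_binomial_case \<alpha> \<beta> \<longleftrightarrow> Im \<alpha> = 0 \<and> Im \<beta> = 0 \<and> Re \<alpha> > Re \<beta> \<and> Re \<beta> > 0"

definition meixner_case :: "complex \<Rightarrow> complex \<Rightarrow> bool" where
  "meixner_case \<alpha> \<beta> \<longleftrightarrow> Re \<alpha> \<ge> 0 \<and> Im \<alpha> > 0 \<and> \<beta> = cnj \<alpha>"

text \<open>
  In each of the three cases \<open>\<alpha> + \<beta>\<close> and \<open>\<alpha> * \<beta>\<close> are real, so that taking real parts
  below loses nothing.
\<close>

definition par_lambda :: "complex \<Rightarrow> complex \<Rightarrow> real" where
  "par_lambda \<alpha> \<beta> = Re (\<alpha> + \<beta>)"

definition par_eta :: "complex \<Rightarrow> complex \<Rightarrow> real" where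
  "par_eta \<alpha> \<beta> = Re (\<alpha> * \<beta>)"

definition par_l :: "complex \<Rightarrow> real \<Rightarrow> real" where
  "par_l \<alpha> \<sigma> = (if Im \<alpha> = 0 then \<sigma> / Re \<alpha> else 0)"

definition sq_norm :: "complex \<Rightarrow> complex \<Rightarrow> real \<Rightarrow> nat \<Rightarrow> real" where
  "sq_norm \<alpha> \<beta> \<sigma> n = fact n * gen_fact \<sigma> (- par_eta \<alpha> \<beta>) n"

text \<open>
  The recurrence \<open>x s\<^sub>n(x) = s\<^sub>n\<^sub>+\<^sub>1(x) + (\<lambda> n + l) s\<^sub>n(x) + (\<sigma> n + \<eta> n (n - 1)) s\<^sub>n\<^sub>-\<^sub>1(x)\<close>,
  solved for \<open>s\<^sub>n\<^sub>+\<^sub>1\<close>; the coefficient of \<open>s\<^sub>n\<^sub>-\<^sub>1\<close> vanishes for \<open>n = 0\<close>.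
\<close>

fun s_poly :: "complex \<Rightarrow> complex \<Rightarrow> real \<Rightarrow> nat \<Rightarrow> real poly" where
  "s_poly \<alpha> \<beta> \<sigma> 0 = 1"
| "s_poly \<alpha> \<beta> \<sigma> (Suc 0) = [:- par_l \<alpha> \<sigma>, 1:]"
| "s_poly \<alpha> \<beta> \<sigma> (Suc (Suc m)) = (let n = real (Suc m) in
     [:- (par_lambda \<alpha> \<beta> * n + par_l \<alpha> \<sigma>), 1:] * s_poly \<alpha> \<beta> \<sigma> (Suc m)
     - smult (\<sigma> * n + par_eta \<alpha> \<beta> * n * (n - 1)) (s_poly \<alpha> \<beta> \<sigma> m))"

definition s_fun :: "complex \<Rightarrow> complex \<Rightarrow> real \<Rightarrow> nat \<Rightarrow> real \<Rightarrow> complex" where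
  "s_fun \<alpha> \<beta> \<sigma> n x = complex_of_real (poly (s_poly \<alpha> \<beta> \<sigma> n) x)"

definition X_set :: "complex \<Rightarrow> complex \<Rightarrow> real set" where
  "X_set \<alpha> \<beta> =
     (if gamma_case \<alpha> \<beta> then {0<..}
      else if neg_binomial_case \<alpha> \<beta> then range (\<lambda>n::nat. (Re \<alpha> - Re \<beta>) * real n)
      else UNIV)"

definition gamma_density :: "real \<Rightarrow> real \<Rightarrow> real \<Rightarrow> real" where
  "gamma_density a \<sigma> x =
     (let \<eta> = a * a in
      1 / Gamma (\<sigma> / \<eta>) * a powr (- \<sigma> / \<eta>) * x powr (- 1 + \<sigma> / \<eta>) * exp (- x / a))"

definition neg_binomial_weight :: "real \<Rightarrow> real \<Rightarrow> real \<Rightarrow> nat \<Rightarrow> real" where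
  "neg_binomial_weight a b \<sigma> n =
     (let \<eta> = a * b in
      (1 - b / a) powr (\<sigma> / \<eta>) * ((b / a) ^ n * (1 / fact n) * pochhammer (\<sigma> / \<eta>) n))"

definition meixner_const :: "complex \<Rightarrow> complex \<Rightarrow> real \<Rightarrow> real" where
  "meixner_const \<alpha> \<beta> \<sigma> =
     (let \<eta> = par_eta \<alpha> \<beta> in
      (2 * cos (pi / 2 - Arg \<alpha>)) powr (\<sigma> / \<eta>) / (4 * Im \<alpha> * pi * Gamma (\<sigma> / \<eta>))
      * exp ((pi / 2 - Arg \<alpha>) * \<sigma> * Re \<alpha> / (Im \<alpha> * \<eta>)))"

definition meixner_density :: "complex \<Rightarrow> complex \<Rightarrow> real \<Rightarrow> real \<Rightarrow> real" where
  "meixner_density \<alpha> \<beta> \<sigma> x =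
     (let \<eta> = par_eta \<alpha> \<beta> in
      meixner_const \<alpha> \<beta> \<sigma> * exp ((pi / 2 - Arg \<alpha>) * x / Im \<alpha>)
      * (cmod (Gamma (\<i> * of_real x / of_real (2 * Im \<alpha>)
                      + \<i> * of_real \<sigma> * \<beta> / of_real (2 * \<eta> * Im \<alpha>))))\<^sup>2)"

text \<open>
  The measure lives on the Borel sets of \<open>X_set \<alpha> \<beta>\<close>, hence its space is \<open>X_set \<alpha> \<beta>\<close> in all cases.
  In the second case, pushing the point weights on \<open>\<nat>\<close> forward yields
  \<open>\<Sum>n. w\<^sub>n \<delta>\<^bsub>(\<alpha> - \<beta>) n\<^esub>\<close>.
\<close>

definition mu :: "complex \<Rightarrow> complex \<Rightarrow> real \<Rightarrow> real measure" where
  "mu \<alpha> \<beta> \<sigma> =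
     (if gamma_case \<alpha> \<beta> then
        density (restrict_space lborel (X_set \<alpha> \<beta>)) (\<lambda>x. ennreal (gamma_density (Re \<alpha>) \<sigma> x))
      else if neg_binomial_case \<alpha> \<beta> then
        distr (point_measure UNIV (\<lambda>n. ennreal (neg_binomial_weight (Re \<alpha>) (Re \<beta>) \<sigma> n)))
              (restrict_space borel (X_set \<alpha> \<beta>)) (\<lambda>n. (Re \<alpha> - Re \<beta>) * real n)
      else density (restrict_space lborel (X_set \<alpha> \<beta>)) (\<lambda>x. ennreal (meixner_density \<alpha> \<beta> \<sigma> x)))"

definition D_set :: "complex \<Rightarrow> complex \<Rightarrow> real \<Rightarrow> complex set" where
  "D_set \<alpha> \<beta> \<sigma> = (if cmod \<alpha> = cmod \<beta> then {z. Re (\<alpha> * z) > - \<sigma> / 2} else UNIV)"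

definition F_expansion ::
    "complex \<Rightarrow> complex \<Rightarrow> real \<Rightarrow> (complex \<Rightarrow> complex) \<Rightarrow> (nat \<Rightarrow> complex) \<Rightarrow> bool" where
  "F_expansion \<alpha> \<beta> \<sigma> \<phi> f \<longleftrightarrow>
     summable (\<lambda>n. (cmod (f n))\<^sup>2 * sq_norm \<alpha> \<beta> \<sigma> n) \<and>
     (\<forall>z\<in>D_set \<alpha> \<beta> \<sigma>. (\<lambda>n. f n * gen_fact z \<beta> n) sums \<phi> z)"

text \<open>
  Functions on \<open>D_set \<alpha> \<beta> \<sigma>\<close> are represented by total functions whose values outside this set
  are irrelevant; so equality in \<open>F_space \<alpha> \<beta> \<sigma>\<close> means equality on \<open>D_set \<alpha> \<beta> \<sigma>\<close>.
\<close>

definition F_space :: "complex \<Rightarrow> complex \<Rightarrow> real \<Rightarrow> (complex \<Rightarrow> complex) set" where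
  "F_space \<alpha> \<beta> \<sigma> = {\<phi>. \<phi> holomorphic_on D_set \<alpha> \<beta> \<sigma> \<and> (\<exists>f. F_expansion \<alpha> \<beta> \<sigma> \<phi> f)}"

text \<open>
  The coefficients are unique: all points \<open>k \<beta>\<close> with \<open>k \<in> \<nat>\<close> lie in \<open>D_set \<alpha> \<beta> \<sigma>\<close>, and
  \<open>(k \<beta> | \<beta>)\<^sub>n\<close> vanishes exactly for \<open>n > k\<close>.
\<close>

definition F_coeff :: "complex \<Rightarrow> complex \<Rightarrow> real \<Rightarrow> (complex \<Rightarrow> complex) \<Rightarrow> nat \<Rightarrow> complex" where
  "F_coeff \<alpha> \<beta> \<sigma> \<phi> = (THE f. F_expansion \<alpha> \<beta> \<sigma> \<phi> f)"

definition F_inner ::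
    "complex \<Rightarrow> complex \<Rightarrow> real \<Rightarrow> (complex \<Rightarrow> complex) \<Rightarrow> (complex \<Rightarrow> complex) \<Rightarrow> complex" where
  "F_inner \<alpha> \<beta> \<sigma> \<phi> \<psi> =
     (\<Sum>n. F_coeff \<alpha> \<beta> \<sigma> \<phi> n * cnj (F_coeff \<alpha> \<beta> \<sigma> \<psi> n) * of_real (sq_norm \<alpha> \<beta> \<sigma> n))"

text \<open>
  Unitary operators from \<open>L\<^sup>2\<close> to \<open>F_space\<close>, as maps on representatives: well defined, linear,
  inner-product preserving and onto.
\<close>

definition unitary_L2_F ::
    "complex \<Rightarrow> complex \<Rightarrow> real \<Rightarrow> ((real \<Rightarrow> complex) \<Rightarrow> complex \<Rightarrow> complex) \<Rightarrow> bool" where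
  "unitary_L2_F \<alpha> \<beta> \<sigma> S \<longleftrightarrow>
     (let M = mu \<alpha> \<beta> \<sigma>; D = D_set \<alpha> \<beta> \<sigma> in
      (\<forall>f\<in>L2 M. S f \<in> F_space \<alpha> \<beta> \<sigma>) \<and>
      (\<forall>f\<in>L2 M. \<forall>g\<in>L2 M. (AE x in M. f x = g x) \<longrightarrow> (\<forall>z\<in>D. S f z = S g z)) \<and>
      (\<forall>f\<in>L2 M. \<forall>g\<in>L2 M. \<forall>a b. \<forall>z\<in>D. S (\<lambda>x. a * f x + b * g x) z = a * S f z + b * S g z) \<and>
      (\<forall>f\<in>L2 M. \<forall>g\<in>L2 M. F_inner \<alpha> \<beta> \<sigma> (S f) (S g) = L2_inner M f g) \<and>
      (\<forall>\<phi>\<in>F_space \<alpha> \<beta> \<sigma>. \<exists>f\<in>L2 M. \<forall>z\<in>D. S f z = \<phi> z))"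

definition E_term :: "complex \<Rightarrow> complex \<Rightarrow> real \<Rightarrow> complex \<Rightarrow> nat \<Rightarrow> real \<Rightarrow> complex" where
  "E_term \<alpha> \<beta> \<sigma> z n x = gen_fact z \<beta> n / of_real (sq_norm \<alpha> \<beta> \<sigma> n) * s_fun \<alpha> \<beta> \<sigma> n x"

text \<open>
  \<open>E_kernel \<alpha> \<beta> \<sigma> x z\<close> as a function of \<open>x\<close> is a representative of the sum of the series in \<open>L\<^sup>2\<close>;
  it is determined up to null sets.
\<close>

definition E_kernel :: "complex \<Rightarrow> complex \<Rightarrow> real \<Rightarrow> real \<Rightarrow> complex \<Rightarrow> complex" where
  "E_kernel \<alpha> \<beta> \<sigma> x z = (SOME g. L2_sums (mu \<alpha> \<beta> \<sigma>) (E_term \<alpha> \<beta> \<sigma> z) g) x"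

end

theory Submission
  imports Defs "HOL-Probability.Characteristic_Functions" "HOL-Real_Asymp.Real_Asymp"
begin

text \<open>
  Let \<open>G z\<close> denote the explicit formula for \<open>\<E>(\<cdot>, z)\<close>. In each case \<open>G z\<close> lies in \<open>L\<^sup>2\<close>, has
  integral 1, and satisfies
  \<open>(x - l) G z = (\<alpha> z + \<sigma>) / \<beta> G (z + \<beta>) - ((\<alpha> - \<beta>) z + \<sigma>) / \<beta> G z\<close>. Since \<open>G 0 = 1\<close>, this puts
  all polynomials into \<open>L\<^sup>2\<close>, and the three-term recurrence gives
  \<open>\<integral> G z \<cdot> s\<^sub>n = (z | \<beta>)\<^sub>n\<close> by induction. The operator \<open>S\<close> identifies \<open>\<integral> f \<cdot> s\<^sub>n / \<parallel>s\<^sub>n\<parallel>\<^sup>2\<close> as the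
  coefficients of \<open>S f\<close>, so that Parseval's identity makes every \<open>f\<close>, in particular \<open>G z\<close>, the
  \<open>L\<^sup>2\<close> sum of its expansion in the \<open>s\<^sub>n\<close>.

  The normalization is Euler's integral for the gamma distribution and the binomial series for
  the negative binomial one. For the Meixner distribution it is an integral of
  \<open>exp (2 \<theta> y) \<Gamma>(a - iy) \<Gamma>(b + iy)\<close>: rotating Euler's integral writes both Gamma factors as
  Fourier transforms of functions \<open>exp (w t - c exp t)\<close> with \<open>\<bar>c\<bar> = 1\<close>, and Parseval's identity
  for the Fourier transform reduces it to Euler's integral again.
\<close>

subsection \<open>Square-integrable functions\<close>

text \<open>The difference equation is the three-term recurrence seen through \<open>S\<close>:
  multiplication by x turns into an operator in z that combines the values at z and z + \<beta>. For
  the explicit kernels it comes from \<Gamma>(w + 1) = w \<Gamma>(w) or its Pochhammer analogue,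
  where the shift by \<beta> releases a linear factor. Orthogonality and completeness of the
  polynomials enter through the hypothesis on \<open>S\<close>. Square integrability is where the
  domain appears. In the gamma and Meixner cases the norm of G z becomes an integral whose Gamma
  exponents have positive real part for z in the domain; in the negative binomial case the norm
  series has term ratio tending to \<beta>/\<alpha> < 1 for every z. The obstacle in the Meixner
  case is the factor exp (2 \<theta> y), which competes with the decay of \<Gamma> along vertical
  lines. It is absorbed into the phase of the rate c = exp (-i \<theta>), admissible because
  \<bar>\<theta>\<bar> < \<pi>/2 means Re c > 0; Parseval then delivers integrability and value
  together. Since \<open>E_kernel\<close> is an arbitrary representative, comparison with G z is
  almost everywhere, hence pointwise only at atoms.\<close>

lemma L2_measurable [measurable_dest]: "f \<in> L2 M \<Longrightarrow> f \<in> borel_measurable M"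
  by (simp add: L2_def)

lemma L2_mult_integrable:
  assumes f: "f \<in> L2 M" and g: "g \<in> L2 M"
  shows "integrable M (\<lambda>x. f x * g x)"
proof (rule Bochner_Integration.integrable_bound)
  show "integrable M (\<lambda>x. (cmod (f x))\<^sup>2 + (cmod (g x))\<^sup>2)"
    using f g by (auto simp: L2_def)
  show "(\<lambda>x. f x * g x) \<in> borel_measurable M"
    using L2_measurable[OF f] L2_measurable[OF g] by measurable
  have "a * b \<le> a\<^sup>2 + b\<^sup>2" if "a \<ge> 0" "b \<ge> 0" for a b :: real
    using sum_squares_bound[of a b] mult_nonneg_nonneg[OF that] by linarith
  then show "AE x in M. norm (f x * g x) \<le> norm ((cmod (f x))\<^sup>2 + (cmod (g x))\<^sup>2)"
    by (auto simp: norm_mult)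
qed

lemma L2_cmult:
  assumes f: "f \<in> L2 M"
  shows "(\<lambda>x. c * f x) \<in> L2 M"
  using L2_measurable[OF f] f by (auto simp: L2_def norm_mult power_mult_distrib)

lemma L2_add:
  assumes f: "f \<in> L2 M" and g: "g \<in> L2 M"
  shows "(\<lambda>x. f x + g x) \<in> L2 M"
proof -
  have [measurable]: "f \<in> borel_measurable M" "g \<in> borel_measurable M"
    using f g by (auto simp: L2_def)
  have "integrable M (\<lambda>x. (cmod (f x + g x))\<^sup>2)"
  proof (rule Bochner_Integration.integrable_bound)
    show "integrable M (\<lambda>x. 2 * (cmod (f x))\<^sup>2 + 2 * (cmod (g x))\<^sup>2)"
      using f g by (auto simp: L2_def)
    have "(cmod (f x + g x))\<^sup>2 \<le> 2 * (cmod (f x))\<^sup>2 + 2 * (cmod (g x))\<^sup>2" for x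
    proof -
      have "(cmod (f x + g x))\<^sup>2 \<le> (cmod (f x) + cmod (g x))\<^sup>2"
        by (intro power_mono norm_triangle_ineq) auto
      also have "\<dots> \<le> 2 * (cmod (f x))\<^sup>2 + 2 * (cmod (g x))\<^sup>2"
        using sum_squares_bound[of "cmod (f x)" "cmod (g x)"] by (simp add: power2_sum)
      finally show ?thesis .
    qed
    then show "AE x in M. norm ((cmod (f x + g x))\<^sup>2)
        \<le> norm (2 * (cmod (f x))\<^sup>2 + 2 * (cmod (g x))\<^sup>2)"
      by auto
  qed auto
  then show ?thesis by (simp add: L2_def)
qed

lemma L2_diff: "f \<in> L2 M \<Longrightarrow> g \<in> L2 M \<Longrightarrow> (\<lambda>x. f x - g x) \<in> L2 M"
  using L2_add[of f M "\<lambda>x. (- 1) * g x"] L2_cmult[of g M "- 1"] by simp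

lemma L2_zero: "(\<lambda>x. 0) \<in> L2 M"
  by (simp add: L2_def)

lemma L2_sum:
  assumes "\<And>i. i \<in> I \<Longrightarrow> f i \<in> L2 M"
  shows "(\<lambda>x. \<Sum>i\<in>I. f i x) \<in> L2 M"
proof (cases "finite I")
  case True
  then show ?thesis using assms
    by (induction I rule: finite_induct) (auto simp: L2_zero L2_add)
qed (simp add: L2_zero)

lemma L2_cong:
  assumes "\<And>x. x \<in> space M \<Longrightarrow> f x = g x"
  shows "f \<in> L2 M \<longleftrightarrow> g \<in> L2 M"
  unfolding L2_def mem_Collect_eq
  by (intro conj_cong measurable_cong Bochner_Integration.integrable_cong) (simp_all add: assms)

lemma L2_cnj:
  assumes f: "f \<in> L2 M"
  shows "(\<lambda>x. cnj (f x)) \<in> L2 M"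
  using L2_measurable[OF f] f
  by (auto simp: L2_def intro: measurable_compose[OF _ borel_measurable_continuous_onI]
      continuous_intros)

text \<open>The integral of (t \<bar>f\<bar> + \<bar>g\<bar>)^2 is a nonnegative quadratic in t, so
  its discriminant is not positive. The pairing carries no conjugate because the representation of
  \<open>S\<close> is bilinear in f and the kernel.\<close>

lemma integral_Cauchy_Schwarz:
  assumes f: "f \<in> L2 M" and g: "g \<in> L2 M"
  shows "(cmod (\<integral>x. f x * g x \<partial>M))\<^sup>2 \<le> (\<integral>x. (cmod (f x))\<^sup>2 \<partial>M) * (\<integral>x. (cmod (g x))\<^sup>2 \<partial>M)"
proof -
  define a where "a = (\<integral>x. (cmod (f x))\<^sup>2 \<partial>M)"
  define b where "b = (\<integral>x. (cmod (g x))\<^sup>2 \<partial>M)"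
  define c where "c = (\<integral>x. cmod (f x) * cmod (g x) \<partial>M)"
  have int: "integrable M (\<lambda>x. (cmod (f x))\<^sup>2)" "integrable M (\<lambda>x. (cmod (g x))\<^sup>2)"
    "integrable M (\<lambda>x. cmod (f x) * cmod (g x))"
    using f g integrable_norm[OF L2_mult_integrable[OF f g]] by (auto simp: L2_def norm_mult)
  have q: "a * t\<^sup>2 + 2 * c * t + b \<ge> 0" for t
  proof -
    have "0 \<le> (\<integral>x. (t * cmod (f x) + cmod (g x))\<^sup>2 \<partial>M)"
      by (rule Bochner_Integration.integral_nonneg) simp
    also have "(\<lambda>x. (t * cmod (f x) + cmod (g x))\<^sup>2)
        = (\<lambda>x. t\<^sup>2 * (cmod (f x))\<^sup>2 + 2 * t * (cmod (f x) * cmod (g x)) + (cmod (g x))\<^sup>2)"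
      by (intro ext) (simp add: power2_sum power_mult_distrib algebra_simps)
    also have "integral\<^sup>L M \<dots> = t\<^sup>2 * a + 2 * t * c + b"
      using int by (simp add: a_def b_def c_def)
    finally show ?thesis by (simp add: mult.commute mult.left_commute)
  qed
  have "c\<^sup>2 \<le> a * b"
  proof (cases "a = 0")
    case True
    have "c = 0"
    proof (rule ccontr)
      assume "c \<noteq> 0"
      \<comment> \<open>With a = 0 the quadratic is 2 c t + b, and this t gives it the value
        -1.\<close>
      then show False using q[of "- (b + 1) / (2 * c)"] True by (simp add: field_simps)
    qed
    then show ?thesis using True by simp
  next
    case False
    have "a \<ge> 0" by (simp add: a_def)
    with False have "a > 0" by simp
    \<comment> \<open>The point t = - c / a minimizes the quadratic; the factor a clears the
      denominator.\<close>
    have "a * (a * (- c / a)\<^sup>2 + 2 * c * (- c / a) + b) \<ge> 0"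
      using q[of "- c / a"] \<open>a > 0\<close> by (intro mult_nonneg_nonneg) auto
    also have "a * (a * (- c / a)\<^sup>2 + 2 * c * (- c / a) + b) = a * b - c\<^sup>2"
      using \<open>a > 0\<close> by (simp add: field_simps power2_eq_square)
    finally show ?thesis by simp
  qed
  moreover have "cmod (\<integral>x. f x * g x \<partial>M) \<le> c"
    using integral_norm_bound[of M "\<lambda>x. f x * g x"] by (simp add: c_def norm_mult)
  ultimately show ?thesis
    unfolding a_def[symmetric] b_def[symmetric] using power_mono norm_ge_zero order_trans by metis
qed

lemma L2_sums_integral:
  assumes u: "L2_sums M u g" and f: "f \<in> L2 M"
  shows "(\<lambda>n. \<integral>x. f x * u n x \<partial>M) sums (\<integral>x. f x * g x \<partial>M)"
proof -
  have uL: "u n \<in> L2 M" for n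
    using u by (auto simp: L2_sums_def)
  have gL: "g \<in> L2 M"
    and lim: "(\<lambda>N. \<integral>x. (cmod (g x - (\<Sum>n<N. u n x)))\<^sup>2 \<partial>M) \<longlonglongrightarrow> 0"
    using u by (auto simp: L2_sums_def)
  define h where "h N = (\<lambda>x. g x - (\<Sum>n<N. u n x))" for N
  have hL: "h N \<in> L2 M" for N
    unfolding h_def by (intro L2_diff gL L2_sum uL)
  have eq: "(\<integral>x. f x * h N x \<partial>M) = (\<integral>x. f x * g x \<partial>M) - (\<Sum>n<N. \<integral>x. f x * u n x \<partial>M)" for N
    unfolding h_def right_diff_distrib sum_distrib_left
    by (subst Bochner_Integration.integral_diff)
       (auto intro!: L2_mult_integrable f gL uL Bochner_Integration.integrable_sum
        Bochner_Integration.integral_sum)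
  have "(\<lambda>N. \<integral>x. f x * h N x \<partial>M) \<longlonglongrightarrow> 0"
  proof (rule Lim_null_comparison)
    let ?b = "\<lambda>N. sqrt ((\<integral>x. (cmod (f x))\<^sup>2 \<partial>M) * (\<integral>x. (cmod (h N x))\<^sup>2 \<partial>M))"
    show "\<forall>\<^sub>F N in sequentially. norm (\<integral>x. f x * h N x \<partial>M) \<le> ?b N"
      by (intro always_eventually allI real_le_rsqrt integral_Cauchy_Schwarz f hL)
    have "?b \<longlonglongrightarrow> sqrt ((\<integral>x. (cmod (f x))\<^sup>2 \<partial>M) * 0)"
      unfolding h_def by (intro tendsto_intros lim)
    then show "?b \<longlonglongrightarrow> 0" by simp
  qed
  then have "(\<lambda>N. (\<integral>x. f x * g x \<partial>M) - (\<integral>x. f x * h N x \<partial>M)) \<longlonglongrightarrow> (\<integral>x. f x * g x \<partial>M) - 0"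
    by (intro tendsto_intros)
  then show ?thesis by (simp add: sums_def eq)
qed

text \<open>Integrating both sums against the conjugate of d = g - h gives the same series, and the
  difference of the two values is the squared norm of d.\<close>

lemma L2_sums_unique:
  assumes g: "L2_sums M u g" and h: "L2_sums M u h"
  shows "AE x in M. g x = h x"
proof -
  have gL: "g \<in> L2 M" and hL: "h \<in> L2 M" using g h by (auto simp: L2_sums_def)
  define d where "d = (\<lambda>x. g x - h x)"
  have dL: "d \<in> L2 M" unfolding d_def by (intro L2_diff gL hL)
  have "(\<integral>x. cnj (d x) * g x \<partial>M) = (\<integral>x. cnj (d x) * h x \<partial>M)"
    using L2_sums_integral[OF g L2_cnj[OF dL]] L2_sums_integral[OF h L2_cnj[OF dL]] sums_unique2
    by blast
  then have "(\<integral>x. cnj (d x) * g x - cnj (d x) * h x \<partial>M) = 0"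
    by (subst Bochner_Integration.integral_diff) (auto intro!: L2_mult_integrable L2_cnj dL gL hL)
  moreover have "cnj (d x) * g x - cnj (d x) * h x = of_real ((cmod (d x))\<^sup>2)" for x
    by (simp only: d_def complex_norm_square) (simp add: algebra_simps)
  ultimately have "complex_of_real (\<integral>x. (cmod (d x))\<^sup>2 \<partial>M) = 0"
    by (simp only: integral_complex_of_real)
  then have "(\<integral>x. (cmod (d x))\<^sup>2 \<partial>M) = 0"
    by (simp only: of_real_eq_0_iff)
  then have "AE x in M. (cmod (d x))\<^sup>2 = 0"
    using dL by (subst (asm) integral_nonneg_eq_0_iff_AE) (auto simp: L2_def)
  then show ?thesis by (simp add: d_def)
qed

section \<open>Generalized factorials\<close>

lemma gen_fact_Suc: "gen_fact z h (Suc n) = gen_fact z h n * (z - of_nat n * h)"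
  by (simp add: gen_fact_def)

lemma gen_fact_shift: "gen_fact (z + h) h (Suc n) = (z + h) * gen_fact z h n"
  unfolding gen_fact_def by (subst prod.lessThan_Suc_shift) (simp add: algebra_simps)

lemma gen_fact_eq_pochhammer:
  fixes h :: "'a :: field"
  assumes "h \<noteq> 0"
  shows "gen_fact z (- h) n = h ^ n * pochhammer (z / h) n"
  using assms by (induction n) (auto simp: gen_fact_def pochhammer_Suc field_simps)

text \<open>At the nodes k h a Newton series breaks off after the index k, so its coefficients solve
  a triangular system.\<close>

lemma gen_fact_multiple:
  fixes h :: "'a :: field_char_0"
  assumes "h \<noteq> 0"
  shows "gen_fact (of_nat k * h) h n = 0 \<longleftrightarrow> k < n"
  using assms by (auto simp: gen_fact_def)

subsection \<open>Expansion of the kernel\<close>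

lemma s_fun_0: "s_fun \<alpha> \<beta> \<sigma> 0 x = 1"
  by (simp add: s_fun_def)

lemma s_fun_Suc:
  "s_fun \<alpha> \<beta> \<sigma> (Suc n) x
     = (of_real x - of_real (par_l \<alpha> \<sigma>) - of_real (par_lambda \<alpha> \<beta>) * of_nat n) * s_fun \<alpha> \<beta> \<sigma> n x
       - of_nat n * (of_real \<sigma> + of_real (par_eta \<alpha> \<beta>) * (of_nat n - 1)) * s_fun \<alpha> \<beta> \<sigma> (n - 1) x"
  by (cases n) (simp_all add: s_fun_def Let_def algebra_simps)

lemma cnj_s_fun: "cnj (s_fun \<alpha> \<beta> \<sigma> n x) = s_fun \<alpha> \<beta> \<sigma> n x"
  by (simp add: s_fun_def)

lemma zero_in_D_set: "\<sigma> > 0 \<Longrightarrow> 0 \<in> D_set \<alpha> \<beta> \<sigma>"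
  by (simp add: D_set_def)

text \<open>
  The difference equation \<open>G_shift\<close> has the same form in all three cases; together with the
  normalization and the value at \<open>z = 0\<close> it is all that is needed of the explicit kernels.
\<close>

locale kernel_family =
  fixes \<alpha> \<beta> :: complex and \<sigma> :: real and G :: "complex \<Rightarrow> real \<Rightarrow> complex"
  assumes sigma_pos: "\<sigma> > 0"
    and eta_pos: "par_eta \<alpha> \<beta> > 0"
    and eta_eq: "of_real (par_eta \<alpha> \<beta>) = \<alpha> * \<beta>"
    and lambda_eq: "of_real (par_lambda \<alpha> \<beta>) = \<alpha> + \<beta>"
    and G_L2: "z \<in> D_set \<alpha> \<beta> \<sigma> \<Longrightarrow> G z \<in> L2 (mu \<alpha> \<beta> \<sigma>)"
    and G_integral: "z \<in> D_set \<alpha> \<beta> \<sigma> \<Longrightarrow> (\<integral>x. G z x \<partial>mu \<alpha> \<beta> \<sigma>) = 1"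
    and G_0: "x \<in> X_set \<alpha> \<beta> \<Longrightarrow> G 0 x = 1"
    and G_shift: "z \<in> D_set \<alpha> \<beta> \<sigma> \<Longrightarrow> x \<in> X_set \<alpha> \<beta> \<Longrightarrow>
      (of_real x - of_real (par_l \<alpha> \<sigma>)) * G z x
        = (\<alpha> * z + of_real \<sigma>) / \<beta> * G (z + \<beta>) x - ((\<alpha> - \<beta>) * z + of_real \<sigma>) / \<beta> * G z x"
begin

abbreviation "M \<equiv> mu \<alpha> \<beta> \<sigma>"
abbreviation "D \<equiv> D_set \<alpha> \<beta> \<sigma>"
abbreviation "s \<equiv> s_fun \<alpha> \<beta> \<sigma>"
abbreviation "nrm \<equiv> sq_norm \<alpha> \<beta> \<sigma>"

lemma space_M: "space M = X_set \<alpha> \<beta>"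
  by (simp add: mu_def space_restrict_space)

lemma beta_nz: "\<beta> \<noteq> 0"
  using eta_pos eta_eq by auto

text \<open>Adding \<beta> raises Re (\<alpha> z) by \<eta> > 0, so neither the difference equation
  nor the nodes k \<beta> leave the domain.\<close>

lemma D_shift: "z \<in> D \<Longrightarrow> z + \<beta> \<in> D"
  using eta_pos by (auto simp: D_set_def par_eta_def algebra_simps)

lemma multiple_in_D: "of_nat k * \<beta> \<in> D"
proof (induction k)
  case 0
  then show ?case using zero_in_D_set[OF sigma_pos] by simp
next
  case (Suc k)
  then show ?case using D_shift[of "of_nat k * \<beta>"] by (simp add: algebra_simps)
qed

lemma nrm_pos: "nrm n > 0"
  unfolding sq_norm_def gen_fact_def
  using sigma_pos eta_pos by (auto intro!: mult_pos_pos prod_pos add_pos_nonneg)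

text \<open>
  By \<open>G_shift\<close>, multiplication by \<open>x\<close> stays within the span of the kernels, so that no moments of
  the measure have to be estimated.
\<close>

lemma power_G_L2: "z \<in> D \<Longrightarrow> (\<lambda>x. of_real x ^ k * G z x) \<in> L2 M"
proof (induction k arbitrary: z)
  case 0
  then show ?case using G_L2 by simp
next
  case (Suc k)
  define A where "A = (\<alpha> * z + of_real \<sigma>) / \<beta>"
  define B where "B = of_real (par_l \<alpha> \<sigma>) - ((\<alpha> - \<beta>) * z + of_real \<sigma>) / \<beta>"
  have "(\<lambda>x. A * (of_real x ^ k * G (z + \<beta>) x) + B * (of_real x ^ k * G z x)) \<in> L2 M"
    using Suc D_shift by (intro L2_add L2_cmult) auto
  moreover have "of_real x ^ Suc k * G z x
      = A * (of_real x ^ k * G (z + \<beta>) x) + B * (of_real x ^ k * G z x)" if "x \<in> space M" for x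
  proof -
    have "of_real x * G z x = A * G (z + \<beta>) x + B * G z x"
      using G_shift[OF Suc.prems, of x] that unfolding A_def B_def space_M by (simp add: algebra_simps)
    then have "of_real x ^ k * (of_real x * G z x) = of_real x ^ k * (A * G (z + \<beta>) x + B * G z x)"
      by simp
    then show ?thesis by (simp add: algebra_simps)
  qed
  ultimately show ?case using L2_cong by (metis (no_types, lifting))
qed

lemma poly_L2: "(\<lambda>x. complex_of_real (poly p x)) \<in> L2 M"
proof -
  have "(\<lambda>x. \<Sum>i\<le>degree p. of_real (coeff p i) * (of_real x ^ i * G 0 x)) \<in> L2 M"
    by (intro L2_sum L2_cmult power_G_L2 zero_in_D_set sigma_pos)
  moreover have "complex_of_real (poly p x)
      = (\<Sum>i\<le>degree p. of_real (coeff p i) * (of_real x ^ i * G 0 x))" if "x \<in> space M" for x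
    using that by (simp add: poly_altdef G_0 space_M)
  ultimately show ?thesis using L2_cong by (metis (no_types, lifting))
qed

lemma s_L2: "s n \<in> L2 M"
  using poly_L2 unfolding s_fun_def[abs_def] .

lemma G_s_integrable: "z \<in> D \<Longrightarrow> integrable M (\<lambda>x. G z x * s n x)"
  by (intro L2_mult_integrable G_L2 s_L2)

lemma integral_G_s: "z \<in> D \<Longrightarrow> (\<integral>x. G z x * s n x \<partial>M) = gen_fact z \<beta> n"
\<comment> \<open>The point must be arbitrary because the difference equation moves z to z +
  \<beta>; the recurrence reaches back two indices, hence strong induction.\<close>
proof (induction n arbitrary: z rule: less_induct)
  case (less n)
  show ?case
  proof (cases n)
    case 0
    then show ?thesis using less.prems by (simp add: s_fun_0 G_integral gen_fact_def)
  next
    case (Suc m)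
    \<comment> \<open>\<open>A\<close> and \<open>B\<close> come from \<open>G_shift\<close>, with
      the term \<lambda> m of the recurrence moved into \<open>B\<close>; l drops out because both
      relations are used in terms of x - l.\<close>
    define A where "A = (\<alpha> * z + of_real \<sigma>) / \<beta>"
    define B where "B = ((\<alpha> - \<beta>) * z + of_real \<sigma>) / \<beta> + (\<alpha> + \<beta>) * of_nat m"
    define C where "C = of_nat m * (of_real \<sigma> + \<alpha> * \<beta> * (of_nat m - 1))"
    have z: "z \<in> D" "z + \<beta> \<in> D" using less.prems D_shift by auto
    have "(\<integral>x. G z x * s n x \<partial>M)
      = (\<integral>x. A * (G (z + \<beta>) x * s m x) - B * (G z x * s m x) - C * (G z x * s (m - 1) x) \<partial>M)"
    proof (rule Bochner_Integration.integral_cong)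
      fix x assume "x \<in> space M"
      then have "(of_real x - of_real (par_l \<alpha> \<sigma>)) * G z x * s m x
        = (A * G (z + \<beta>) x - (B - (\<alpha> + \<beta>) * of_nat m) * G z x) * s m x"
        using G_shift[OF z(1), of x] by (simp add: space_M A_def B_def)
      then show "G z x * s n x
         = A * (G (z + \<beta>) x * s m x) - B * (G z x * s m x) - C * (G z x * s (m - 1) x)"
        unfolding Suc s_fun_Suc eta_eq lambda_eq C_def by (simp add: algebra_simps)
    qed simp
    also have "\<dots> = A * (\<integral>x. G (z + \<beta>) x * s m x \<partial>M) - B * (\<integral>x. G z x * s m x \<partial>M)
        - C * (\<integral>x. G z x * s (m - 1) x \<partial>M)"
      using G_s_integrable[OF z(1)] G_s_integrable[OF z(2)] by simp
    also have "\<dots> = A * gen_fact (z + \<beta>) \<beta> m - B * gen_fact z \<beta> m - C * gen_fact z \<beta> (m - 1)"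
      using less.IH[of m] less.IH[of "m - 1"] Suc z by simp
    also have "\<dots> = gen_fact z \<beta> n"
    \<comment> \<open>For m = 0 the truncated index m - 1 is harmless since \<open>C\<close> = 0.
      The common factor extracted in the other case requires m = k + 1.\<close>
    proof (cases m)
      case 0
      then show ?thesis unfolding Suc A_def B_def C_def
        using beta_nz by (simp add: gen_fact_def field_simps)
    next
      case (Suc k)
      define p where "p = gen_fact z \<beta> k"
      \<comment> \<open>This is what remains of the claim once the factor \<open>p\<close>, common
        to all terms, is taken out.\<close>
      have "A * (z + \<beta>) - B * (z - of_nat k * \<beta>) - C
          = (z - of_nat k * \<beta>) * (z - (of_nat k + 1) * \<beta>)"
        unfolding A_def B_def C_def Suc using beta_nz by (simp add: field_simps)
      then have "(A * (z + \<beta>) - B * (z - of_nat k * \<beta>) - C) * p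
          = (z - of_nat k * \<beta>) * (z - (of_nat k + 1) * \<beta>) * p"
        by simp
      moreover have "gen_fact (z + \<beta>) \<beta> m = (z + \<beta>) * p" "gen_fact z \<beta> m = p * (z - of_nat k * \<beta>)"
        "gen_fact z \<beta> (m - 1) = p"
        "gen_fact z \<beta> n = p * (z - of_nat k * \<beta>) * (z - (of_nat k + 1) * \<beta>)"
        unfolding \<open>n = Suc m\<close> Suc p_def by (simp_all add: gen_fact_shift) (simp_all add: gen_fact_Suc)
      ultimately show ?thesis
        by algebra
    qed
    finally show ?thesis .
  qed
qed

lemma F_expansion_unique:
  assumes "F_expansion \<alpha> \<beta> \<sigma> \<phi> f" "F_expansion \<alpha> \<beta> \<sigma> \<phi> g"
  shows "f = g"
proof
  fix k
  show "f k = g k"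
  proof (induction k rule: less_induct)
    case (less k)
    define d where "d n = f n - g n" for n
    have "(\<lambda>n. f n * gen_fact (of_nat k * \<beta>) \<beta> n - g n * gen_fact (of_nat k * \<beta>) \<beta> n)
        sums (\<phi> (of_nat k * \<beta>) - \<phi> (of_nat k * \<beta>))"
      using assms multiple_in_D by (intro sums_diff) (auto simp: F_expansion_def)
    then have "(\<lambda>n. d n * gen_fact (of_nat k * \<beta>) \<beta> n) sums 0"
      by (simp add: d_def algebra_simps)
    moreover have "(\<lambda>n. d n * gen_fact (of_nat k * \<beta>) \<beta> n)
        = (\<lambda>n. if n = k then d k * gen_fact (of_nat k * \<beta>) \<beta> k else 0)"
    proof
      fix n
      \<comment> \<open>Terms below k vanish by the induction hypothesis, terms above k by the
        choice of the node.\<close>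
      consider "n < k" | "n = k" | "n > k" by linarith
      then show "d n * gen_fact (of_nat k * \<beta>) \<beta> n
          = (if n = k then d k * gen_fact (of_nat k * \<beta>) \<beta> k else 0)"
        using less beta_nz by cases (auto simp: d_def gen_fact_multiple)
    qed
    ultimately have "d k * gen_fact (of_nat k * \<beta>) \<beta> k = 0"
      using sums_single[of k "\<lambda>n. d k * gen_fact (of_nat k * \<beta>) \<beta> k"] sums_unique2 by metis
    then show ?case using beta_nz by (simp add: d_def gen_fact_multiple)
  qed
qed

lemma F_coeff_eqI: "F_expansion \<alpha> \<beta> \<sigma> \<phi> f \<Longrightarrow> F_coeff \<alpha> \<beta> \<sigma> \<phi> = f"
  unfolding F_coeff_def using F_expansion_unique by blast

end

section \<open>Orthogonal expansion and kernel representation from unitarity\<close>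

locale kernel_unitary = kernel_family +
  fixes S :: "(real \<Rightarrow> complex) \<Rightarrow> complex \<Rightarrow> complex"
  assumes unitary: "unitary_L2_F \<alpha> \<beta> \<sigma> S"
    and S_s: "z \<in> D_set \<alpha> \<beta> \<sigma> \<Longrightarrow> S (s_fun \<alpha> \<beta> \<sigma> n) z = gen_fact z \<beta> n"
begin

definition coef :: "(real \<Rightarrow> complex) \<Rightarrow> nat \<Rightarrow> complex" where
  "coef f n = (\<integral>x. f x * s n x \<partial>M) / of_real (nrm n)"

lemma S_inner:
  assumes "f \<in> L2 M" "g \<in> L2 M"
  shows "F_inner \<alpha> \<beta> \<sigma> (S f) (S g) = (\<integral>x. f x * cnj (g x) \<partial>M)"
  using unitary assms unfolding unitary_L2_F_def Let_def L2_inner_def by blast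

lemma F_expansion_s: "F_expansion \<alpha> \<beta> \<sigma> (S (s n)) (\<lambda>k. if k = n then 1 else 0)"
  unfolding F_expansion_def
proof (intro conjI ballI)
  show "summable (\<lambda>k. (cmod (if k = n then 1 else 0))\<^sup>2 * nrm k)"
    by (rule summable_finite[of "{n}"]) auto
  fix z assume "z \<in> D"
  then show "(\<lambda>k. (if k = n then 1 else 0) * gen_fact z \<beta> k) sums S (s n) z"
    using sums_single[of n "gen_fact z \<beta>"] by (simp add: S_s if_distrib[of "\<lambda>t. t * _"] cong: if_cong)
qed

text \<open>The image of \<open>s n\<close> has a unit vector as coefficient sequence, so the inner
  product of \<open>S f\<close> with it isolates the n-th coefficient. Isometry turns this into an
  integral, and the conjugate disappears because \<open>s n\<close> is real.\<close>

lemma F_expansion_coef: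
  assumes f: "f \<in> L2 M"
  shows "F_expansion \<alpha> \<beta> \<sigma> (S f) (coef f)"
proof -
  have "S f \<in> F_space \<alpha> \<beta> \<sigma>"
    using unitary f unfolding unitary_L2_F_def Let_def by blast
  then obtain c where c: "F_expansion \<alpha> \<beta> \<sigma> (S f) c"
    by (auto simp: F_space_def)
  have "c n = coef f n" for n
  proof -
    have "(\<integral>x. f x * s n x \<partial>M) = F_inner \<alpha> \<beta> \<sigma> (S f) (S (s n))"
      using S_inner[OF f s_L2] by (simp add: cnj_s_fun)
    also have "\<dots> = (\<Sum>k. if k = n then c k * of_real (nrm k) else 0)"
      unfolding F_inner_def F_coeff_eqI[OF c] F_coeff_eqI[OF F_expansion_s]
      by (intro suminf_cong) auto
    also have "\<dots> = c n * of_real (nrm n)"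
      using sums_single[of n "\<lambda>k. c k * of_real (nrm k)"] by (simp add: sums_iff)
    finally show ?thesis
      unfolding coef_def using nrm_pos[of n] by simp
  qed
  then have "c = coef f" by auto
  with c show ?thesis by simp
qed

lemma Parseval:
  assumes f: "f \<in> L2 M"
  shows "(\<lambda>n. (cmod (coef f n))\<^sup>2 * nrm n) sums (\<integral>x. (cmod (f x))\<^sup>2 \<partial>M)"
proof -
  have "summable (\<lambda>n. (cmod (coef f n))\<^sup>2 * nrm n)"
    using F_expansion_coef[OF f] by (simp add: F_expansion_def)
  then have *: "(\<lambda>n. (cmod (coef f n))\<^sup>2 * nrm n) sums (\<Sum>n. (cmod (coef f n))\<^sup>2 * nrm n)"
    by (rule summable_sums)
  then have "(\<lambda>n. complex_of_real ((cmod (coef f n))\<^sup>2 * nrm n))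
      sums complex_of_real (\<Sum>n. (cmod (coef f n))\<^sup>2 * nrm n)"
    by (rule sums_of_real)
  then have "F_inner \<alpha> \<beta> \<sigma> (S f) (S f) = complex_of_real (\<Sum>n. (cmod (coef f n))\<^sup>2 * nrm n)"
    unfolding F_inner_def F_coeff_eqI[OF F_expansion_coef[OF f]]
    by (simp add: sums_iff complex_norm_square del: of_real_power)
  moreover have "F_inner \<alpha> \<beta> \<sigma> (S f) (S f) = complex_of_real (\<integral>x. (cmod (f x))\<^sup>2 \<partial>M)"
    unfolding S_inner[OF f f] complex_norm_square[symmetric] by (rule integral_complex_of_real)
  ultimately have "(\<Sum>n. (cmod (coef f n))\<^sup>2 * nrm n) = (\<integral>x. (cmod (f x))\<^sup>2 \<partial>M)"
    by (simp only: of_real_eq_iff)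
  with * show ?thesis by simp
qed

text \<open>Orthogonality follows from uniqueness: \<open>S (s m)\<close> has both
  \<open>coef (s m)\<close> and a unit vector as its coefficients.\<close>

lemma integral_s_s: "(\<integral>x. s m x * s n x \<partial>M) = (if m = n then of_real (nrm n) else 0)"
proof -
  have "coef (s m) n = (if n = m then 1 else 0)"
    using F_expansion_unique[OF F_expansion_coef[OF s_L2] F_expansion_s[of m]] by metis
  then show ?thesis
    using nrm_pos[of n] unfolding coef_def by (auto split: if_splits simp: field_simps)
qed

text \<open>Subtracting the first N terms erases the first N coefficients. Parseval for the
  remainder therefore expresses its squared norm as the tail of a convergent series.\<close>

lemma coef_expansion_L2_sums:
  assumes f: "f \<in> L2 M"
  shows "L2_sums M (\<lambda>n x. coef f n * s n x) f"
proof -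
  define u where "u = (\<lambda>n x. coef f n * s n x)"
  have uL: "u n \<in> L2 M" for n unfolding u_def by (intro L2_cmult s_L2)
  have coef_diff: "coef (\<lambda>x. f x - (\<Sum>k<N. u k x)) n = (if n < N then 0 else coef f n)" for N n
  proof -
    have "(\<integral>x. (f x - (\<Sum>k<N. u k x)) * s n x \<partial>M)
        = (\<integral>x. f x * s n x - (\<Sum>k<N. coef f k * (s k x * s n x)) \<partial>M)"
      by (intro Bochner_Integration.integral_cong refl)
         (simp add: u_def algebra_simps sum_distrib_left)
    also have "\<dots> = (\<integral>x. f x * s n x \<partial>M) - (\<Sum>k<N. coef f k * (\<integral>x. s k x * s n x \<partial>M))"
      using L2_mult_integrable[OF f s_L2] L2_mult_integrable[OF s_L2 s_L2]
      by (subst Bochner_Integration.integral_diff) (auto simp: Bochner_Integration.integral_sum)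
    also have "\<dots> = (\<integral>x. f x * s n x \<partial>M) - (if n < N then coef f n * of_real (nrm n) else 0)"
      by (simp add: integral_s_s if_distrib[of "\<lambda>t. _ * t"] sum.delta cong: if_cong)
    finally show ?thesis using nrm_pos[of n] by (simp add: coef_def)
  qed
  have "(\<integral>x. (cmod (f x - (\<Sum>k<N. u k x)))\<^sup>2 \<partial>M)
      = (\<integral>x. (cmod (f x))\<^sup>2 \<partial>M) - (\<Sum>n<N. (cmod (coef f n))\<^sup>2 * nrm n)" for N
  proof -
    have "(\<lambda>n. (cmod (coef f n))\<^sup>2 * nrm n - (if n < N then (cmod (coef f n))\<^sup>2 * nrm n else 0))
        sums ((\<integral>x. (cmod (f x))\<^sup>2 \<partial>M) - (\<Sum>n<N. (cmod (coef f n))\<^sup>2 * nrm n))"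
      using sums_If_finite_set[of "{..<N}" "\<lambda>n. (cmod (coef f n))\<^sup>2 * nrm n"]
      by (intro sums_diff Parseval f) simp
    moreover have "(\<lambda>n. (cmod (coef f n))\<^sup>2 * nrm n - (if n < N then (cmod (coef f n))\<^sup>2 * nrm n else 0))
        sums (\<integral>x. (cmod (f x - (\<Sum>k<N. u k x)))\<^sup>2 \<partial>M)"
      using Parseval[OF L2_diff[OF f L2_sum[of "{..<N}" u, OF uL]]] unfolding coef_diff
      by (rule sums_cong[THEN iffD1, rotated]) auto
    ultimately show ?thesis using sums_unique2 by blast
  qed
  moreover have "(\<lambda>N. (\<integral>x. (cmod (f x))\<^sup>2 \<partial>M) - (\<Sum>n<N. (cmod (coef f n))\<^sup>2 * nrm n))
      \<longlonglongrightarrow> (\<integral>x. (cmod (f x))\<^sup>2 \<partial>M) - (\<integral>x. (cmod (f x))\<^sup>2 \<partial>M)"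
    using Parseval[OF f] by (intro tendsto_intros) (simp add: sums_def)
  ultimately show ?thesis
    unfolding L2_sums_def u_def[symmetric] using uL f by simp
qed

lemma L2_sums_G:
  assumes z: "z \<in> D"
  shows "L2_sums M (E_term \<alpha> \<beta> \<sigma> z) (G z)"
  using coef_expansion_L2_sums[OF G_L2[OF z]]
  unfolding coef_def integral_G_s[OF z] E_term_def[abs_def] .

lemma L2_sums_E_kernel:
  assumes z: "z \<in> D"
  shows "L2_sums M (E_term \<alpha> \<beta> \<sigma> z) (\<lambda>x. E_kernel \<alpha> \<beta> \<sigma> x z)"
  \<comment> \<open>\<open>G z\<close> witnesses that a sum exists, which makes the choice in
    \<open>E_kernel\<close> meaningful.\<close>
  unfolding E_kernel_def by (rule someI[of "L2_sums M (E_term \<alpha> \<beta> \<sigma> z)", OF L2_sums_G[OF z]])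

lemma E_kernel_AE_eq:
  assumes z: "z \<in> D"
  shows "AE x in M. E_kernel \<alpha> \<beta> \<sigma> x z = G z x"
  by (rule L2_sums_unique[OF L2_sums_E_kernel[OF z] L2_sums_G[OF z]])

text \<open>Both sides are sums of one series: the expansion of \<open>S f\<close> at z, and the
  termwise integral of f against the kernel series.\<close>

lemma S_eq_integral_E_kernel:
  assumes z: "z \<in> D" and f: "f \<in> L2 M"
  shows "S f z = (\<integral>x. f x * E_kernel \<alpha> \<beta> \<sigma> x z \<partial>M)"
proof -
  have "(\<lambda>n. coef f n * gen_fact z \<beta> n) sums S f z"
    using F_expansion_coef[OF f] z by (simp add: F_expansion_def)
  moreover have "(\<lambda>n. coef f n * gen_fact z \<beta> n) sums (\<integral>x. f x * E_kernel \<alpha> \<beta> \<sigma> x z \<partial>M)"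
  proof -
    have "(\<integral>x. f x * E_term \<alpha> \<beta> \<sigma> z n x \<partial>M) = coef f n * gen_fact z \<beta> n" for n
    proof -
      have "(\<lambda>x. f x * E_term \<alpha> \<beta> \<sigma> z n x)
          = (\<lambda>x. gen_fact z \<beta> n / of_real (nrm n) * (f x * s n x))"
        by (auto simp: E_term_def)
      then show ?thesis by (simp add: coef_def)
    qed
    then show ?thesis using L2_sums_integral[OF L2_sums_E_kernel[OF z] f] by simp
  qed
  ultimately show ?thesis by (rule sums_unique2)
qed

lemma kernel_representation:
  assumes z: "z \<in> D"
  shows "L2_sums M (E_term \<alpha> \<beta> \<sigma> z) (\<lambda>x. E_kernel \<alpha> \<beta> \<sigma> x z) \<and>
    (\<lambda>x. E_kernel \<alpha> \<beta> \<sigma> x z) \<in> L2 M \<and>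
    (\<forall>f\<in>L2 M. integrable M (\<lambda>x. f x * E_kernel \<alpha> \<beta> \<sigma> x z) \<and>
       S f z = (\<integral>x. f x * E_kernel \<alpha> \<beta> \<sigma> x z \<partial>M))"
proof (intro conjI ballI)
  show "L2_sums M (E_term \<alpha> \<beta> \<sigma> z) (\<lambda>x. E_kernel \<alpha> \<beta> \<sigma> x z)"
    by (rule L2_sums_E_kernel[OF z])
  then show E: "(\<lambda>x. E_kernel \<alpha> \<beta> \<sigma> x z) \<in> L2 M"
    by (simp add: L2_sums_def)
  fix f assume f: "f \<in> L2 M"
  show "integrable M (\<lambda>x. f x * E_kernel \<alpha> \<beta> \<sigma> x z)"
    by (rule L2_mult_integrable[OF f E])
  show "S f z = (\<integral>x. f x * E_kernel \<alpha> \<beta> \<sigma> x z \<partial>M)"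
    by (rule S_eq_integral_E_kernel[OF z f])
qed

end

subsection \<open>Euler's integral with a complex rate\<close>

lemma pochhammer_powser:
  fixes a z :: complex
  assumes "norm z < 1"
  shows "(\<lambda>n. pochhammer a n / fact n * z ^ n) sums (1 - z) powr (- a)"
proof -
  have "(\<lambda>n. ((- a) gchoose n) * (- z) ^ n) sums (1 + (- z)) powr (- a)"
    using assms by (intro gen_binomial_complex) simp
  moreover have "((- a) gchoose n) * (- z) ^ n = pochhammer a n / fact n * z ^ n" for n
  proof -
    have "((- a) gchoose n) * (- z) ^ n = ((- 1) ^ n * (- 1) ^ n) * (pochhammer a n / fact n * z ^ n)"
      by (simp only: gbinomial_pochhammer power_minus[of z n] minus_minus times_divide_eq_left
          times_divide_eq_right mult.assoc mult.left_commute)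
    also have "(- 1) ^ n * (- 1) ^ n = (1 :: complex)"
      by (simp flip: power_mult_distrib)
    finally show ?thesis by simp
  qed
  ultimately show ?thesis by simp
qed

text \<open>Gives a binomial series with nonnegative terms as majorant, for absolute
  convergence.\<close>

lemma norm_pochhammer_le:
  fixes a :: complex
  shows "norm (pochhammer a n) \<le> pochhammer (norm a) n"
proof (induction n)
  case (Suc n)
  have "norm (a + of_nat n) \<le> norm a + real n"
    using norm_triangle_ineq[of a "of_nat n"] by simp
  with Suc show ?case
    by (simp only: pochhammer_Suc norm_mult) (intro mult_mono order_trans[OF norm_ge_zero Suc]; simp)
qed simp

lemma summable_pochhammer_powser:
  fixes a z :: real
  assumes "\<bar>z\<bar> < 1"
  shows "summable (\<lambda>n. pochhammer a n / fact n * z ^ n)"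
proof -
  have "summable (\<lambda>n. complex_of_real (pochhammer a n / fact n * z ^ n))"
    using pochhammer_powser[of "of_real z" "of_real a"] assms
    by (simp add: sums_iff pochhammer_of_real)
  then show ?thesis by (simp only: summable_complex_of_real)
qed

text \<open>Principal powers are not multiplicative in general; a positive real factor leaves the
  argument, and hence the branch, unchanged.\<close>

lemma powr_of_real_mult_powr:
  fixes c w :: complex and M :: real
  assumes "M > 0" "c \<noteq> 0"
  shows "of_real M powr w * (c / of_real M) powr w = c powr w"
proof -
  have "c powr w = (of_real M * (c / of_real M)) powr w" using assms by simp
  also have "\<dots> = of_real M powr w * (c / of_real M) powr w"
    using assms by (subst powr_times_real_left) auto
  finally show ?thesis by simp
qed

definition gamma_integrand :: "complex \<Rightarrow> complex \<Rightarrow> real \<Rightarrow> complex" where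
  "gamma_integrand c w r = indicator {0<..} r *\<^sub>R (of_real r powr (w - 1) * exp (- (c * of_real r)))"

lemma gamma_integrand_measurable [measurable]: "gamma_integrand c w \<in> borel_measurable borel"
  unfolding gamma_integrand_def[abs_def]
  by (intro borel_measurable_continuous_on_indicator continuous_intros) auto

lemma norm_gamma_integrand:
  "norm (gamma_integrand c w r) = indicator {0<..} r * (r powr (Re w - 1) * exp (- (Re c * r)))"
  by (auto simp: gamma_integrand_def norm_mult norm_powr_real_powr indicator_def)

lemma gamma_integrand_1:
  assumes "Re w > 0"
  shows "integrable lborel (gamma_integrand 1 w)" and "integral\<^sup>L lborel (gamma_integrand 1 w) = Gamma w"
proof -
  have eq: "gamma_integrand 1 w = (\<lambda>t. indicator {0<..} t *\<^sub>R (of_real t powr (w - 1) / of_real (exp t)))"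
    by (simp add: gamma_integrand_def exp_minus exp_of_real field_simps fun_eq_iff)
  have "integrable lebesgue (gamma_integrand 1 w)"
    using absolutely_integrable_Gamma_integral'[OF assms] unfolding set_integrable_def eq .
  then show int: "integrable lborel (gamma_integrand 1 w)"
    by (subst (asm) integrable_completion) auto
  have "(LINT t:{0<..}|lborel. complex_of_real t powr (w - 1) / of_real (exp t)) = Gamma w"
    using set_borel_integral_eq_integral(2)[of "{0<..}" "\<lambda>t. complex_of_real t powr (w - 1) / of_real (exp t)"]
      int integral_unique[OF Gamma_integral_complex'[OF assms]]
    unfolding set_integrable_def eq by simp
  then show "integral\<^sup>L lborel (gamma_integrand 1 w) = Gamma w"
    by (simp add: eq set_lebesgue_integral_def)
qed

lemma gamma_integrand_of_real:
  assumes w: "Re w > 0" and M: "M > 0"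
  shows "integrable lborel (gamma_integrand (of_real M) w)"
    and "integral\<^sup>L lborel (gamma_integrand (of_real M) w) = Gamma w * of_real M powr (- w)"
proof -
  have eq: "gamma_integrand 1 w (0 + M * r)
      = (of_real M powr (w - 1)) * gamma_integrand (of_real M) w r" for r
    using M by (auto simp: gamma_integrand_def indicator_def zero_less_mult_iff powr_times_real)
  have nz: "complex_of_real M powr (w - 1) \<noteq> 0" using M by simp
  have "integrable lborel (\<lambda>r. gamma_integrand 1 w (0 + M * r))"
    using gamma_integrand_1(1)[OF w] M by (intro lborel_integrable_real_affine) auto
  then have "integrable lborel (\<lambda>r. inverse (of_real M powr (w - 1)) *
      (of_real M powr (w - 1) * gamma_integrand (of_real M) w r))"
    unfolding eq by (rule integrable_mult_right)
  moreover have "inverse (of_real M powr (w - 1)) * (of_real M powr (w - 1) * t) = t" for t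
    using nz by simp
  ultimately show "integrable lborel (gamma_integrand (of_real M) w)"
    by simp
  have "Gamma w = of_real M * (of_real M powr (w - 1) * integral\<^sup>L lborel (gamma_integrand (of_real M) w))"
  proof -
    have "Gamma w = \<bar>M\<bar> *\<^sub>R (\<integral>r. gamma_integrand 1 w (0 + M * r) \<partial>lborel)"
      by (rule trans[OF gamma_integrand_1(2)[OF w, symmetric] lborel_integral_real_affine])
         (use M in simp)
    also have "(\<integral>r. gamma_integrand 1 w (0 + M * r) \<partial>lborel)
        = of_real M powr (w - 1) * integral\<^sup>L lborel (gamma_integrand (of_real M) w)"
      unfolding eq by (rule integral_mult_right_zero)
    finally show ?thesis using M by (simp add: scaleR_conv_of_real)
  qed
  also have "\<dots> = of_real M powr w * integral\<^sup>L lborel (gamma_integrand (of_real M) w)"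
    using M by (simp add: powr_diff)
  finally show "integral\<^sup>L lborel (gamma_integrand (of_real M) w) = Gamma w * of_real M powr (- w)"
    using M by (simp add: powr_minus field_simps)
qed

text \<open>The modulus of the integrand is the integrand with exponent \<open>Re w\<close>, so
  Euler's integral applies again.\<close>

lemma integral_norm_gamma_integrand:
  assumes w: "Re w > 0" and M: "M > 0"
  shows "(\<integral>r. norm (gamma_integrand (of_real M) w r) \<partial>lborel) = Gamma (Re w) * M powr (- Re w)"
proof -
  have "complex_of_real (norm (gamma_integrand (of_real M) w r))
      = gamma_integrand (of_real M) (of_real (Re w)) r" for r
  proof (cases "r > 0")
    case True
    then have "complex_of_real r powr of_real (Re w - 1) = of_real (r powr (Re w - 1))"
      by (intro powr_of_real) simp
    moreover have "exp (- (complex_of_real M * of_real r)) = of_real (exp (- (M * r)))"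
      by (simp flip: exp_of_real)
    ultimately show ?thesis using True
      unfolding norm_gamma_integrand by (simp add: gamma_integrand_def)
  qed (simp add: gamma_integrand_def)
  then have "complex_of_real (\<integral>r. norm (gamma_integrand (of_real M) w r) \<partial>lborel)
      = (\<integral>r. gamma_integrand (of_real M) (of_real (Re w)) r \<partial>lborel)"
    by (subst integral_complex_of_real[symmetric]) simp
  also have "\<dots> = Gamma (of_real (Re w)) * of_real M powr (- of_real (Re w))"
    using gamma_integrand_of_real(2)[of "of_real (Re w)" M] assms by simp
  also have "\<dots> = complex_of_real (Gamma (Re w) * M powr (- Re w))"
    using M by (simp add: Gamma_complex_of_real powr_of_real[symmetric])
  finally show ?thesis by (simp only: of_real_eq_iff)
qed

text \<open>
  The identity is expanded in \<open>c\<close> around a real rate \<open>M\<close> so large that \<open>\<bar>c - M\<bar> < M\<close>, which makes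
  the binomial series converge; this covers the whole half-plane \<open>Re c > 0\<close> at once.
\<close>

lemma gamma_integrand_complex:
  assumes w: "Re w > 0" and c: "Re c > 0"
  shows "integrable lborel (gamma_integrand c w)"
    and "integral\<^sup>L lborel (gamma_integrand c w) = Gamma w * c powr (- w)"
proof -
  \<comment> \<open>With this rate M Re c = \<bar>c\<bar>^2, so that \<bar>M - c\<bar>^2 = M^2 -
    \<bar>c\<bar>^2 < M^2.\<close>
  define M where "M = (cmod c)\<^sup>2 / Re c"
  have c0: "c \<noteq> 0" using c by auto
  have M: "M > 0" unfolding M_def using c c0 by auto
  define \<rho> where "\<rho> = (of_real M - c) / of_real M"
  have "(cmod (of_real M - c))\<^sup>2 < M\<^sup>2"
  proof -
    have "(cmod (of_real M - c))\<^sup>2 = M\<^sup>2 - 2 * (M * Re c) + (cmod c)\<^sup>2"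
      by (simp add: cmod_power2 power2_diff algebra_simps)
    also have "M * Re c = (cmod c)\<^sup>2" using c by (simp add: M_def)
    finally show ?thesis using c0 by simp
  qed
  then have "cmod (of_real M - c) < M"
    using M by (metis power_less_imp_less_base less_imp_le)
  then have \<rho>: "cmod \<rho> < 1" using M by (simp add: \<rho>_def norm_divide)
  \<comment> \<open>These are the terms of exp ((M - c) r) times the integrand of rate M; the factor
    r^n raises the exponent from w to w + n.\<close>
  define f where "f n r = (of_real M - c) ^ n / fact n * gamma_integrand (of_real M) (w + of_nat n) r" for n r
  have wn: "Re (w + of_nat n) > 0" for n using w by simp
  have int: "integrable lborel (f n)" for n
    unfolding f_def using gamma_integrand_of_real(1)[OF wn M] by simp
  have val: "integral\<^sup>L lborel (f n) = Gamma w * of_real M powr (- w) * (pochhammer w n / fact n * \<rho> ^ n)" for n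
  proof -
    have "w \<notin> \<int>\<^sub>\<le>\<^sub>0" using w by (auto elim!: nonpos_Ints_cases)
    then have "Gamma (w + of_nat n) = pochhammer w n * Gamma w"
      by (simp add: pochhammer_Gamma Gamma_eq_zero_iff)
    moreover have "complex_of_real M powr (- (w + of_nat n)) = of_real M powr (- w) / of_real M ^ n"
      using M by (simp add: powr_diff powr_nat)
    ultimately show ?thesis
      unfolding f_def using gamma_integrand_of_real(2)[OF wn M]
      by (simp add: \<rho>_def power_divide field_simps)
  qed
  have normf: "(\<integral>r. norm (f n r) \<partial>lborel)
      = Gamma (Re w) * M powr (- Re w) * (pochhammer (Re w) n / fact n * cmod \<rho> ^ n)" for n
  proof -
    have "Re w \<notin> \<int>\<^sub>\<le>\<^sub>0" using w by (auto elim!: nonpos_Ints_cases)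
    then have "Gamma (Re w + of_nat n) = pochhammer (Re w) n * Gamma (Re w)"
      by (simp add: pochhammer_Gamma Gamma_eq_zero_iff)
    moreover have "M powr (- (Re w + of_nat n)) = M powr (- Re w) / M ^ n"
      using M by (simp add: powr_diff powr_realpow)
    ultimately show ?thesis
      unfolding f_def norm_mult using integral_norm_gamma_integrand[OF wn M, of n] M
      by (simp add: \<rho>_def norm_divide power_divide norm_power field_simps)
  qed
  have pow: "complex_of_real r powr (w + of_nat n - 1) = of_real r powr (w - 1) * of_real r ^ n"
    if "r > 0" for r n
  proof -
    have "complex_of_real r powr (w + of_nat n - 1) = of_real r powr ((w - 1) + of_nat n)"
      by (simp add: algebra_simps)
    also have "\<dots> = of_real r powr (w - 1) * of_real r powr of_nat n"
      by (rule powr_add)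
    finally show ?thesis using that by (simp add: powr_nat)
  qed
  have sums: "(\<lambda>n. f n r) sums gamma_integrand c w r" for r
  proof (cases "r > 0")
    case True
    have "f n r = gamma_integrand (of_real M) w r * (((of_real M - c) * of_real r) ^ n / fact n)" for n
      using True by (simp add: f_def gamma_integrand_def pow power_mult_distrib)
    moreover have "(\<lambda>n. gamma_integrand (of_real M) w r * (((of_real M - c) * of_real r) ^ n / fact n))
       sums (gamma_integrand (of_real M) w r * exp ((of_real M - c) * of_real r))"
      using exp_converges[of "(of_real M - c) * of_real r"]
      by (intro sums_mult) (simp add: scaleR_conv_of_real field_simps)
    moreover have "gamma_integrand (of_real M) w r * exp ((of_real M - c) * of_real r) = gamma_integrand c w r"
      using True by (simp add: gamma_integrand_def exp_add[symmetric] algebra_simps)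
    ultimately show ?thesis by simp
  qed (simp_all add: f_def gamma_integrand_def)
  have suminf: "(\<Sum>n. f n r) = gamma_integrand c w r" for r
    using sums by (simp add: sums_iff)
  have sumnorm: "summable (\<lambda>n. norm (f n r))" for r
  proof (cases "r > 0")
    case True
    have "norm (f n r) = norm (gamma_integrand (of_real M) w r) * ((cmod (of_real M - c) * r) ^ n / fact n)" for n
      using True by (simp add: f_def gamma_integrand_def pow power_mult_distrib
          norm_mult norm_divide norm_power)
    moreover have "summable (\<lambda>n. (cmod (of_real M - c) * r) ^ n / fact n)"
      using summable_exp[of "cmod (of_real M - c) * r"] by (simp add: field_simps)
    ultimately show ?thesis
      using summable_mult[of _ "norm (gamma_integrand (of_real M) w r)"] by presburger
  qed (simp_all add: f_def gamma_integrand_def)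
  \<comment> \<open>The norms sum to a binomial series in \<bar>\<rho>\<bar> < 1 with real parameter
    Re w, which justifies termwise integration.\<close>
  have sumint: "summable (\<lambda>n. \<integral>r. norm (f n r) \<partial>lborel)"
    unfolding normf using \<rho> by (intro summable_mult summable_pochhammer_powser) simp
  show "integrable lborel (gamma_integrand c w)"
    using integrable_suminf[OF int _ sumint] sumnorm by (simp add: suminf)
  have "(\<lambda>n. integral\<^sup>L lborel (f n)) sums (\<integral>r. gamma_integrand c w r \<partial>lborel)"
    using sums_integral[OF int _ sumint] sumnorm by (simp add: suminf)
  moreover have "(\<lambda>n. integral\<^sup>L lborel (f n)) sums (Gamma w * of_real M powr (- w) * (1 - \<rho>) powr (- w))"
    unfolding val by (intro sums_mult pochhammer_powser \<rho>)
  ultimately have "integral\<^sup>L lborel (gamma_integrand c w) = Gamma w * of_real M powr (- w) * (1 - \<rho>) powr (- w)"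
    by (rule sums_unique2)
  also have "1 - \<rho> = c / of_real M" using M by (simp add: \<rho>_def field_simps)
  finally show "integral\<^sup>L lborel (gamma_integrand c w) = Gamma w * c powr (- w)"
    using powr_of_real_mult_powr[OF M c0, of "- w"] by (simp add: mult.assoc)
qed

subsection \<open>Parseval's identity for the Fourier transform\<close>

lemma borel_measurable_exp_complex [measurable]:
  "(exp :: complex \<Rightarrow> complex) \<in> borel_measurable borel"
  by (intro borel_measurable_continuous_onI continuous_intros)

lemma borel_measurable_cnj [measurable]:
  "cnj \<in> borel_measurable borel"
  by (intro borel_measurable_continuous_onI continuous_intros)

text \<open>The product of A and B is integrable on the plane and dominates the integrand. Used to
  exchange integrals that contain a Fourier character.\<close>

lemma Fubini_bounded_kernel:
  fixes A B :: "real \<Rightarrow> complex" and E :: "real \<Rightarrow> real \<Rightarrow> complex"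
  assumes A: "integrable lborel A" and B: "integrable lborel B"
    and E [measurable]: "(\<lambda>(x, y). E x y) \<in> borel_measurable (lborel \<Otimes>\<^sub>M lborel)"
    and bound: "\<And>x y. norm (E x y) \<le> 1"
  shows "(\<integral>y. B y * (\<integral>x. A x * E x y \<partial>lborel) \<partial>lborel)
    = (\<integral>x. A x * (\<integral>y. B y * E x y \<partial>lborel) \<partial>lborel)"
proof -
  have [measurable]: "A \<in> borel_measurable lborel" "B \<in> borel_measurable lborel"
    using A B by auto
  have int: "integrable (lborel \<Otimes>\<^sub>M lborel) (\<lambda>(x, y). A x * B y * E x y)"
  proof (rule Bochner_Integration.integrable_bound)
    show "integrable (lborel \<Otimes>\<^sub>M lborel) (\<lambda>(x, y). A x * B y)"
    proof (rule lborel_pair.Fubini_integrable)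
      show "integrable lborel (\<lambda>x. \<integral>y. norm (case (x, y) of (x, y) \<Rightarrow> A x * B y) \<partial>lborel)"
        using A by (simp add: norm_mult)
      show "AE x in lborel. integrable lborel (\<lambda>y. case (x, y) of (x, y) \<Rightarrow> A x * B y)"
        using B by simp
    qed measurable
    have "norm (A x * B y * E x y) \<le> norm (A x * B y)" for x y
      using bound[of x y] by (simp add: norm_mult mult_left_le)
    then show "AE p in lborel \<Otimes>\<^sub>M lborel. norm (case p of (x, y) \<Rightarrow> A x * B y * E x y)
        \<le> norm (case p of (x, y) \<Rightarrow> A x * B y)"
      by (auto simp: split_beta)
  qed measurable
  have "(\<integral>y. B y * (\<integral>x. A x * E x y \<partial>lborel) \<partial>lborel)
      = (\<integral>y. (\<integral>x. A x * B y * E x y \<partial>lborel) \<partial>lborel)"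
    by (simp add: mult.assoc mult.left_commute flip: integral_mult_right_zero)
  also have "\<dots> = (\<integral>x. (\<integral>y. A x * B y * E x y \<partial>lborel) \<partial>lborel)"
    by (rule lborel_pair.Fubini_integral[OF int])
  also have "\<dots> = (\<integral>x. A x * (\<integral>y. B y * E x y \<partial>lborel) \<partial>lborel)"
    by (simp add: mult.assoc)
  finally show ?thesis .
qed

lemma iexp_measurable:
  "(\<lambda>(t, y). exp (\<i> * complex_of_real (y * t))) \<in> borel_measurable (lborel \<Otimes>\<^sub>M lborel)"
  "(\<lambda>(t, y). exp (- (\<i> * complex_of_real (y * t)))) \<in> borel_measurable (lborel \<Otimes>\<^sub>M lborel)"
  by measurable

definition fourier :: "(real \<Rightarrow> complex) \<Rightarrow> real \<Rightarrow> complex" where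
  "fourier F y = (\<integral>t. F t * exp (- (\<i> * of_real (y * t))) \<partial>lborel)"

lemma fourier_measurable [measurable]:
  assumes [measurable]: "F \<in> borel_measurable borel"
  shows "fourier F \<in> borel_measurable borel"
  unfolding fourier_def[abs_def] by measurable

lemma norm_fourier_le:
  "norm (fourier F y) \<le> (\<integral>t. norm (F t) \<partial>lborel)"
proof -
  have "norm (fourier F y) \<le> (\<integral>t. norm (F t * exp (- (\<i> * of_real (y * t)))) \<partial>lborel)"
    unfolding fourier_def by (rule integral_norm_bound)
  then show ?thesis by (simp add: norm_mult)
qed

lemma cnj_fourier:
  "cnj (fourier G y) = (\<integral>u. cnj (G u) * exp (\<i> * of_real (y * u)) \<partial>lborel)"
proof -
  have "cnj (fourier G y) = (\<integral>u. cnj (G u * exp (- (\<i> * of_real (y * u)))) \<partial>lborel)"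
    unfolding fourier_def by (rule Bochner_Integration.integral_cnj[symmetric])
  also have "\<dots> = (\<integral>u. cnj (G u) * exp (\<i> * of_real (y * u)) \<partial>lborel)"
    by (intro Bochner_Integration.integral_cong refl) (simp add: exp_cnj)
  finally show ?thesis .
qed

lemma integral_std_normal_iexp:
  "(\<integral>x. of_real (std_normal_density x) * exp (\<i> * of_real (x * v)) \<partial>lborel)
    = complex_of_real (exp (- v\<^sup>2 / 2))"
proof -
  have "complex_of_real (exp (- v\<^sup>2 / 2)) = char std_normal_distribution v"
    by (simp add: char_std_normal_distribution)
  also have "\<dots> = (\<integral>x. std_normal_density x *\<^sub>R exp (\<i> * of_real (v * x)) \<partial>lborel)"
    unfolding char_def by (subst integral_density) auto
  finally show ?thesis by (simp add: scaleR_conv_of_real mult.commute)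
qed

text \<open>The transform of a Gaussian of width 1/e is a Gaussian of width e, which acts as an
  approximate identity as e tends to 0.\<close>

lemma integral_scaled_normal_iexp:
  assumes e: "e > 0"
  shows "(\<integral>y. of_real (std_normal_density (e * y)) * exp (\<i> * of_real (y * v)) \<partial>lborel)
    = of_real (sqrt (2 * pi) / e * std_normal_density (v / e))"
proof -
  let ?f = "\<lambda>x. complex_of_real (std_normal_density x) * exp (\<i> * of_real (x * (v / e)))"
  have "of_real (exp (- (v / e)\<^sup>2 / 2)) = integral\<^sup>L lborel ?f"
    using integral_std_normal_iexp[of "v / e"] by simp
  also have "\<dots> = \<bar>e\<bar> *\<^sub>R (\<integral>y. ?f (0 + e * y) \<partial>lborel)"
    by (rule lborel_integral_real_affine) (use e in simp)
  also have "(\<integral>y. ?f (0 + e * y) \<partial>lborel)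
      = (\<integral>y. of_real (std_normal_density (e * y)) * exp (\<i> * of_real (y * v)) \<partial>lborel)"
    using e by (intro Bochner_Integration.integral_cong refl) simp
  finally show ?thesis
    using e by (simp add: std_normal_density_def scaleR_conv_of_real field_simps)
qed

lemma integrable_std_normal: "integrable lborel std_normal_density"
  using integrable_std_normal_moment[of 0] by simp

lemma integral_std_normal: "(\<integral>x. std_normal_density x \<partial>lborel) = 1"
  by (rule integral_normal_density) simp

text \<open>Only \<open>F\<close> is smoothed below, so boundedness and continuity are asked of
  \<open>F\<close>, while \<open>G\<close> enters through its integrability.\<close>

locale fourier_pair =
  fixes F G :: "real \<Rightarrow> complex" and B :: real
  assumes F: "integrable lborel F" and G: "integrable lborel G"
    and F_bound: "\<And>t. norm (F t) \<le> B"
    and F_cont: "continuous_on UNIV F"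
begin

lemma meas [measurable]: "F \<in> borel_measurable borel" "G \<in> borel_measurable borel"
  using F G by auto

text \<open>The transform of an integrable function is bounded but possibly not integrable; the
  Gaussian factor makes the inverse integral converge.\<close>

lemma integrable_damped:
  assumes e: "e > 0"
  shows "integrable lborel (\<lambda>y. fourier F y * of_real (std_normal_density (e * y)))"
proof (rule Bochner_Integration.integrable_bound)
  show "integrable lborel (\<lambda>y. (\<integral>t. norm (F t) \<partial>lborel) * std_normal_density (0 + e * y))"
    using e by (intro integrable_mult_right lborel_integrable_real_affine integrable_std_normal) simp
  show "AE y in lborel. norm (fourier F y * of_real (std_normal_density (e * y)))
      \<le> norm ((\<integral>t. norm (F t) \<partial>lborel) * std_normal_density (0 + e * y))"
    by (auto simp: norm_mult intro!: mult_right_mono norm_fourier_le)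
qed measurable

text \<open>The convolution of \<open>F\<close> with a centered normal density of standard deviation
  e > 0, substituted so that e occurs only in the argument of \<open>F\<close> and a fixed density
  can dominate the limit.\<close>

definition smooth :: "real \<Rightarrow> real \<Rightarrow> complex" where
  "smooth e u = (\<integral>x. F (u + e * x) * of_real (std_normal_density x) \<partial>lborel)"

text \<open>Damped Fourier inversion: integrating over y first leaves a Gaussian in (t - u) / e
  against \<open>F\<close>.\<close>

lemma integral_damped_iexp:
  assumes e: "e > 0"
  shows "(\<integral>y. fourier F y * of_real (std_normal_density (e * y)) * exp (\<i> * of_real (y * u)) \<partial>lborel)
    = of_real (sqrt (2 * pi)) * smooth e u"
proof -
  let ?k = "\<lambda>y. complex_of_real (std_normal_density (e * y)) * exp (\<i> * of_real (y * u))"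
  have k: "integrable lborel ?k"
  proof (rule Bochner_Integration.integrable_bound)
    show "integrable lborel (\<lambda>y. std_normal_density (0 + e * y))"
      using e by (intro lborel_integrable_real_affine integrable_std_normal) simp
  qed (auto simp: norm_mult)
  have "(\<integral>y. fourier F y * of_real (std_normal_density (e * y)) * exp (\<i> * of_real (y * u)) \<partial>lborel)
      = (\<integral>y. ?k y * (\<integral>t. F t * exp (- (\<i> * of_real (y * t))) \<partial>lborel) \<partial>lborel)"
    by (simp add: fourier_def mult_ac)
  also have "\<dots> = (\<integral>t. F t * (\<integral>y. ?k y * exp (- (\<i> * of_real (y * t))) \<partial>lborel) \<partial>lborel)"
    by (rule Fubini_bounded_kernel[OF F k iexp_measurable(2)]) simp
  also have "\<dots> = (\<integral>t. F t * of_real (sqrt (2 * pi) / e * std_normal_density ((t - u) / e)) \<partial>lborel)"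
  proof (intro Bochner_Integration.integral_cong refl)
    fix t
    have "(\<integral>y. ?k y * exp (- (\<i> * of_real (y * t))) \<partial>lborel)
        = (\<integral>y. of_real (std_normal_density (e * y)) * exp (\<i> * of_real (y * (u - t))) \<partial>lborel)"
      by (intro Bochner_Integration.integral_cong refl)
         (simp add: mult.assoc right_diff_distrib flip: exp_add)
    also have "\<dots> = of_real (sqrt (2 * pi) / e * std_normal_density ((u - t) / e))"
      by (rule integral_scaled_normal_iexp[OF e])
    also have "std_normal_density ((u - t) / e) = std_normal_density ((t - u) / e)"
      by (simp add: std_normal_density_def power2_commute power_divide)
    finally show "F t * (\<integral>y. ?k y * exp (- (\<i> * of_real (y * t))) \<partial>lborel)
        = F t * of_real (sqrt (2 * pi) / e * std_normal_density ((t - u) / e))"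
      by (rule arg_cong)
  qed
  \<comment> \<open>Substitution t = u + e x; its Jacobian cancels the factor 1 / e.\<close>
  also have "\<dots> = \<bar>e\<bar> *\<^sub>R (\<integral>x. F (u + e * x)
      * of_real (sqrt (2 * pi) / e * std_normal_density (((u + e * x) - u) / e)) \<partial>lborel)"
    by (rule lborel_integral_real_affine) (use e in simp)
  also have "\<dots> = \<bar>e\<bar> *\<^sub>R (\<integral>x. of_real (sqrt (2 * pi) / e)
      * (F (u + e * x) * of_real (std_normal_density x)) \<partial>lborel)"
    using e by (intro arg_cong2[of _ _ _ _ scaleR] Bochner_Integration.integral_cong refl) simp
  also have "\<dots> = of_real (sqrt (2 * pi)) * smooth e u"
    using e unfolding integral_mult_right_zero smooth_def by (simp add: scaleR_conv_of_real)
  finally show ?thesis .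
qed

text \<open>Writing out the transform of \<open>G\<close> and exchanging the integrals applies
  damped inversion to \<open>F\<close>.\<close>

lemma damped_Parseval:
  assumes e: "e > 0"
  shows "(\<integral>y. fourier F y * cnj (fourier G y) * of_real (std_normal_density (e * y)) \<partial>lborel)
    = of_real (sqrt (2 * pi)) * (\<integral>u. smooth e u * cnj (G u) \<partial>lborel)"
proof -
  have "(\<integral>y. fourier F y * cnj (fourier G y) * of_real (std_normal_density (e * y)) \<partial>lborel)
      = (\<integral>y. (fourier F y * of_real (std_normal_density (e * y)))
          * (\<integral>u. cnj (G u) * exp (\<i> * of_real (y * u)) \<partial>lborel) \<partial>lborel)"
    by (simp add: cnj_fourier mult_ac)
  also have "\<dots> = (\<integral>u. cnj (G u) * (\<integral>y. (fourier F y * of_real (std_normal_density (e * y)))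
      * exp (\<i> * of_real (y * u)) \<partial>lborel) \<partial>lborel)"
    by (rule Fubini_bounded_kernel[OF _ integrable_damped[OF e] iexp_measurable(1)]) (use G in simp_all)
  also have "\<dots> = (\<integral>u. of_real (sqrt (2 * pi)) * (smooth e u * cnj (G u)) \<partial>lborel)"
    unfolding integral_damped_iexp[OF e] by (simp add: mult_ac)
  finally show ?thesis by simp
qed

text \<open>\<open>smooth e u\<close> is an average of values of \<open>F\<close> over a probability
  density.\<close>

lemma norm_smooth_le: "norm (smooth e u) \<le> B"
proof -
  have "norm (smooth e u) \<le> (\<integral>x. B * std_normal_density x \<partial>lborel)"
    unfolding smooth_def
  proof (rule Bochner_Integration.integral_norm_bound_integral)
    show int: "integrable lborel (\<lambda>x. B * std_normal_density x)"
      by (intro integrable_mult_right integrable_std_normal)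
    show "norm (F (u + e * x) * of_real (std_normal_density x)) \<le> B * std_normal_density x" for x
      by (auto simp: norm_mult intro!: mult_right_mono F_bound)
    then show "integrable lborel (\<lambda>x. F (u + e * x) * of_real (std_normal_density x))"
      by (intro Bochner_Integration.integrable_bound[OF int]) (auto intro: order_trans[OF _ abs_ge_self])
  qed
  then show ?thesis by (simp add: integral_std_normal)
qed

lemma smooth_tendsto:
  assumes e: "e \<longlonglongrightarrow> 0"
  shows "(\<lambda>n. smooth (e n) u) \<longlonglongrightarrow> F u"
proof -
  have "(\<lambda>n. smooth (e n) u) \<longlonglongrightarrow> (\<integral>x. F u * of_real (std_normal_density x) \<partial>lborel)"
    unfolding smooth_def
  proof (rule integral_dominated_convergence)
    show "integrable lborel (\<lambda>x. B * std_normal_density x)"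
      by (intro integrable_mult_right integrable_std_normal)
    show "AE x in lborel. norm (F (u + e n * x) * of_real (std_normal_density x)) \<le> B * std_normal_density x" for n
      by (auto simp: norm_mult intro!: mult_right_mono F_bound)
    have "(\<lambda>n. F (u + e n * x)) \<longlonglongrightarrow> F (u + 0 * x)" for x
      using F_cont by (intro continuous_on_tendsto_compose[of UNIV F] tendsto_intros e) auto
    then show "AE x in lborel. (\<lambda>n. F (u + e n * x) * of_real (std_normal_density x))
        \<longlonglongrightarrow> F u * of_real (std_normal_density x)"
      by (auto intro!: tendsto_intros)
  qed measurable
  also have "(\<integral>x. F u * of_real (std_normal_density x) \<partial>lborel) = F u"
    by (simp add: integral_std_normal)
  finally show ?thesis .
qed

lemma damped_Parseval_tendsto:
  assumes e: "e \<longlonglongrightarrow> 0" "\<And>n. e n > 0"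
  shows "(\<lambda>n. \<integral>y. fourier F y * cnj (fourier G y) * of_real (std_normal_density (e n * y)) \<partial>lborel)
    \<longlonglongrightarrow> of_real (sqrt (2 * pi)) * (\<integral>u. F u * cnj (G u) \<partial>lborel)"
  unfolding damped_Parseval[OF e(2)]
proof (intro tendsto_mult tendsto_const integral_dominated_convergence[where w = "\<lambda>u. B * norm (G u)"])
  have [measurable]: "smooth (e n) \<in> borel_measurable borel" for n
    unfolding smooth_def by measurable
  show "(\<lambda>u. smooth (e n) u * cnj (G u)) \<in> borel_measurable lborel" for n
    by measurable
  show "(\<lambda>u. F u * cnj (G u)) \<in> borel_measurable lborel"
    by measurable
  show "integrable lborel (\<lambda>u. B * norm (G u))"
    using G by auto
  show "AE u in lborel. (\<lambda>n. smooth (e n) u * cnj (G u)) \<longlonglongrightarrow> F u * cnj (G u)"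
    by (auto intro!: tendsto_intros smooth_tendsto e)
  show "AE u in lborel. norm (smooth (e n) u * cnj (G u)) \<le> B * norm (G u)" for n
    by (auto simp: norm_mult intro!: mult_right_mono norm_smooth_le)
qed

end

lemma fourier_pair_I:
  assumes "integrable lborel F" "integrable lborel G" "\<And>t. norm (F t) \<le> B" "continuous_on UNIV F"
  shows "fourier_pair F G B"
  using assms by (simp add: fourier_pair_def)

lemma damping_sequence:
  "(\<lambda>n. 1 / real (Suc n)) \<longlonglongrightarrow> 0" "1 / real (Suc n) > 0"
  using LIMSEQ_inverse_real_of_nat by (simp_all add: inverse_eq_divide del: of_nat_Suc)

lemma std_normal_density_damping_tendsto:
  "(\<lambda>n. std_normal_density (1 / real (Suc n) * y)) \<longlonglongrightarrow> 1 / sqrt (2 * pi)"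
proof -
  have "(\<lambda>n. 1 / sqrt (2 * pi) * exp (- (1 / real (Suc n) * y)\<^sup>2 / 2))
      \<longlonglongrightarrow> 1 / sqrt (2 * pi) * exp (- (0 * y)\<^sup>2 / 2)"
    by (intro tendsto_intros damping_sequence) auto
  then show ?thesis by (simp add: std_normal_density_def)
qed

text \<open>
  Monotone convergence with \<open>G = F\<close> yields square integrability of the transform; dominated
  convergence can be applied to the general case only afterwards.
\<close>

lemma integrable_norm_fourier_square:
  assumes F: "integrable lborel F" "\<And>t. norm (F t) \<le> B" "continuous_on UNIV F"
  shows "integrable lborel (\<lambda>y. (norm (fourier F y))\<^sup>2)"
proof -
  interpret fourier_pair F F B by (intro fourier_pair_I F)
  define e where "e n = 1 / real (Suc n)" for n
  define f where "f n y = (norm (fourier F y))\<^sup>2 * std_normal_density (e n * y)" for n y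
  have e: "e \<longlonglongrightarrow> 0" "e n > 0" for n
    using damping_sequence unfolding e_def by auto
  have f_eq: "complex_of_real (f n y)
      = fourier F y * cnj (fourier F y) * of_real (std_normal_density (e n * y))" for n y
    by (simp add: f_def complex_norm_square del: of_real_power)
  have int: "integrable lborel (f n)" for n
  proof (rule Bochner_Integration.integrable_bound)
    show "integrable lborel (\<lambda>y. (\<integral>t. norm (F t) \<partial>lborel) * norm (fourier F y * of_real (std_normal_density (e n * y))))"
      by (intro integrable_mult_right integrable_norm integrable_damped e)
    show "f n \<in> borel_measurable lborel"
      unfolding f_def by measurable
    have "norm (f n y) \<le> (\<integral>t. norm (F t) \<partial>lborel) * norm (fourier F y * of_real (std_normal_density (e n * y)))" for y
      using norm_fourier_le[of F y]
      by (auto simp: f_def power2_eq_square norm_mult mult.assoc intro!: mult_right_mono)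
    then show "AE y in lborel. norm (f n y)
        \<le> norm ((\<integral>t. norm (F t) \<partial>lborel) * norm (fourier F y * of_real (std_normal_density (e n * y))))"
      by (auto intro: order_trans[OF _ abs_ge_self])
  qed
  have "integrable lborel (\<lambda>y. (norm (fourier F y))\<^sup>2 * (1 / sqrt (2 * pi)))"
  proof (rule integrable_monotone_convergence[OF int])
    \<comment> \<open>As the damping parameter decreases, the Gaussian factor increases at every
      y.\<close>
    have "f m y \<le> f n y" if "m \<le> n" for m n y
    proof -
      have "e n \<le> e m" using that by (simp add: e_def frac_le)
      then have "\<bar>e n * y\<bar> \<le> \<bar>e m * y\<bar>"
        using e(2)[of n] e(2)[of m] by (auto simp: abs_mult intro!: mult_right_mono)
      then have "(e n * y)\<^sup>2 \<le> (e m * y)\<^sup>2" by (simp only: abs_le_square_iff)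
      then show ?thesis
        by (auto simp: f_def std_normal_density_def intro!: mult_left_mono divide_right_mono)
    qed
    then show "AE y in lborel. mono (\<lambda>n. f n y)"
      by (auto simp: mono_def)
    show "AE y in lborel. (\<lambda>n. f n y) \<longlonglongrightarrow> (norm (fourier F y))\<^sup>2 * (1 / sqrt (2 * pi))"
      unfolding f_def e_def by (intro AE_I2 tendsto_intros std_normal_density_damping_tendsto)
    have "(\<lambda>n. complex_of_real (integral\<^sup>L lborel (f n)))
        \<longlonglongrightarrow> of_real (sqrt (2 * pi)) * (\<integral>u. F u * cnj (F u) \<partial>lborel)"
      using damped_Parseval_tendsto[OF e] unfolding f_eq[symmetric] integral_complex_of_real .
    then show "(\<lambda>n. integral\<^sup>L lborel (f n))
        \<longlonglongrightarrow> Re (of_real (sqrt (2 * pi)) * (\<integral>u. F u * cnj (F u) \<partial>lborel))"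
      by (auto dest: tendsto_Re)
  qed measurable
  then show ?thesis by (subst (asm) Bochner_Integration.integrable_mult_right_iff) simp
qed

theorem Parseval_fourier:
  assumes hF: "integrable lborel F" "\<And>t. norm (F t) \<le> B" "continuous_on UNIV F"
    and hG: "integrable lborel G" "\<And>t. norm (G t) \<le> C" "continuous_on UNIV G"
  shows "integrable lborel (\<lambda>y. fourier F y * cnj (fourier G y))"
    and "(\<integral>y. fourier F y * cnj (fourier G y) \<partial>lborel)
      = of_real (2 * pi) * (\<integral>t. F t * cnj (G t) \<partial>lborel)"
proof -
  interpret fourier_pair F G B by (intro fourier_pair_I hF hG)
  have sq: "integrable lborel (\<lambda>y. (norm (fourier F y))\<^sup>2 + (norm (fourier G y))\<^sup>2)"
    by (intro Bochner_Integration.integrable_add integrable_norm_fourier_square[of F B]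
        integrable_norm_fourier_square[of G C] hF hG)
  have le: "norm (fourier F y) * norm (fourier G y) \<le> (norm (fourier F y))\<^sup>2 + (norm (fourier G y))\<^sup>2" for y
    using sum_squares_bound[of "norm (fourier F y)" "norm (fourier G y)"]
      mult_nonneg_nonneg[OF norm_ge_zero norm_ge_zero, of "fourier F y" "fourier G y"] by linarith
  show int: "integrable lborel (\<lambda>y. fourier F y * cnj (fourier G y))"
    by (rule Bochner_Integration.integrable_bound[OF sq]) (use le in \<open>auto simp: norm_mult\<close>)
  define e where "e n = 1 / real (Suc n)" for n
  have e: "e \<longlonglongrightarrow> 0" "e n > 0" for n
    using damping_sequence unfolding e_def by auto
  \<comment> \<open>A second limit for the sequence of \<open>damped_Parseval_tendsto\<close>;
    equating the two limits gives the identity.\<close>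
  have "(\<lambda>n. \<integral>y. fourier F y * cnj (fourier G y) * of_real (std_normal_density (e n * y)) \<partial>lborel)
      \<longlonglongrightarrow> (\<integral>y. fourier F y * cnj (fourier G y) * of_real (1 / sqrt (2 * pi)) \<partial>lborel)"
  proof (rule integral_dominated_convergence)
    show "AE y in lborel. (\<lambda>n. fourier F y * cnj (fourier G y) * of_real (std_normal_density (e n * y)))
        \<longlonglongrightarrow> fourier F y * cnj (fourier G y) * of_real (1 / sqrt (2 * pi))"
      unfolding e_def by (intro AE_I2 tendsto_intros std_normal_density_damping_tendsto)
    have "std_normal_density x \<le> 1" for x
    proof -
      have "1 \<le> sqrt (2 * pi)" using pi_gt3 by simp
      moreover have "exp (- x\<^sup>2 / 2) \<le> 1" by simp
      ultimately have "exp (- x\<^sup>2 / 2) \<le> sqrt (2 * pi)" by linarith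
      then show ?thesis by (simp add: std_normal_density_def)
    qed
    then have "norm (fourier F y * cnj (fourier G y) * of_real (std_normal_density (e n * y)))
        \<le> norm (fourier F y * cnj (fourier G y))" for n y
      by (simp add: norm_mult mult_left_le)
    then show "AE y in lborel. norm (fourier F y * cnj (fourier G y) * of_real (std_normal_density (e n * y)))
        \<le> norm (fourier F y * cnj (fourier G y))" for n
      by auto
    show "integrable lborel (\<lambda>y. norm (fourier F y * cnj (fourier G y)))"
      by (rule integrable_norm[OF int])
  qed measurable
  then have "(\<integral>y. fourier F y * cnj (fourier G y) \<partial>lborel) * of_real (1 / sqrt (2 * pi))
      = of_real (sqrt (2 * pi)) * (\<integral>u. F u * cnj (G u) \<partial>lborel)"
    using damped_Parseval_tendsto[OF e] LIMSEQ_unique unfolding integral_mult_left_zero by blast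
  then have "(\<integral>y. fourier F y * cnj (fourier G y) \<partial>lborel)
      = of_real (sqrt (2 * pi)) * of_real (sqrt (2 * pi)) * (\<integral>u. F u * cnj (G u) \<partial>lborel)"
    by (simp add: field_simps)
  also have "complex_of_real (sqrt (2 * pi)) * of_real (sqrt (2 * pi)) = of_real (2 * pi)"
    by (simp only: of_real_mult[symmetric]) simp
  finally show "(\<integral>y. fourier F y * cnj (fourier G y) \<partial>lborel)
      = of_real (2 * pi) * (\<integral>t. F t * cnj (G t) \<partial>lborel)" .
qed

subsection \<open>Integrals of products of Gamma functions\<close>

text \<open>The change of variables is made for Lebesgue measurable functions; Borel measurability
  of f carries the result back to \<open>lborel\<close>.\<close>

lemma
  fixes f :: "real \<Rightarrow> complex"
  assumes f: "integrable lborel (\<lambda>r. indicator {0<..} r *\<^sub>R f r)"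
    and m [measurable]: "f \<in> borel_measurable borel"
  shows integrable_exp_substitution: "integrable lborel (\<lambda>t. exp t *\<^sub>R f (exp t))"
    and integral_exp_substitution: "(\<integral>t. exp t *\<^sub>R f (exp t) \<partial>lborel) = (\<integral>r. indicator {0<..} r *\<^sub>R f r \<partial>lborel)"
proof -
  have rng: "range exp = {0::real<..}"
    by (auto simp: image_iff) (metis exp_ln)
  have abs: "f absolutely_integrable_on {0<..}"
    unfolding set_integrable_def using f by (subst integrable_completion) auto
  have "(\<lambda>t. \<bar>exp t\<bar> *\<^sub>R f (exp t)) absolutely_integrable_on UNIV \<and>
      integral UNIV (\<lambda>t. \<bar>exp t\<bar> *\<^sub>R f (exp t)) = integral {0<..} f"
    using has_absolute_integral_change_of_variables_real[of UNIV exp exp f "integral {0<..} f"] abs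
    unfolding rng by (auto intro: inj_onI DERIV_exp)
  then have 1: "integrable lebesgue (\<lambda>t. exp t *\<^sub>R f (exp t))"
    and 2: "integral UNIV (\<lambda>t. exp t *\<^sub>R f (exp t)) = integral {0<..} f"
    by (simp_all add: set_integrable_def)
  from 1 show 3: "integrable lborel (\<lambda>t. exp t *\<^sub>R f (exp t))"
    by (subst (asm) integrable_completion) auto
  have "(\<integral>r. indicator {0<..} r *\<^sub>R f r \<partial>lborel) = integral {0<..} f"
    using set_borel_integral_eq_integral(2)[of "{0<..}" f] f
    by (simp add: set_integrable_def set_lebesgue_integral_def)
  also have "\<dots> = (\<integral>t. exp t *\<^sub>R f (exp t) \<partial>lborel)"
    using integral_lborel[OF 3] 2 by simp
  finally show "(\<integral>t. exp t *\<^sub>R f (exp t) \<partial>lborel) = (\<integral>r. indicator {0<..} r *\<^sub>R f r \<partial>lborel)" ..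
qed

text \<open>Euler's integrand in the variable t = ln r. The Jacobian turns the exponent w - 1 into
  w, and replacing w by w - i y amounts to multiplying by a Fourier character.\<close>

definition log_gamma_integrand :: "complex \<Rightarrow> complex \<Rightarrow> real \<Rightarrow> complex" where
  "log_gamma_integrand c w t = exp (w * of_real t - c * of_real (exp t))"

lemma continuous_log_gamma_integrand: "continuous_on UNIV (log_gamma_integrand c w)"
  unfolding log_gamma_integrand_def[abs_def] by (intro continuous_intros)

lemma log_gamma_integrand:
  assumes w: "Re w > 0" and c: "Re c > 0"
  shows "integrable lborel (log_gamma_integrand c w)"
    and "integral\<^sup>L lborel (log_gamma_integrand c w) = Gamma w * c powr (- w)"
proof -
  have sub: "exp t *\<^sub>R gamma_integrand c w (exp t) = log_gamma_integrand c w t" for t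
  proof -
    have "complex_of_real (exp t) powr (w - 1) = exp ((w - 1) * of_real t)"
      by (simp add: powr_def Ln_of_real)
    then show ?thesis
      by (simp add: gamma_integrand_def log_gamma_integrand_def scaleR_conv_of_real
          exp_diff exp_minus divide_inverse algebra_simps flip: exp_of_real)
  qed
  have ind: "indicator {0<..} r *\<^sub>R gamma_integrand c w r = gamma_integrand c w r" for r
    by (simp add: gamma_integrand_def indicator_def)
  show "integrable lborel (log_gamma_integrand c w)"
    using integrable_exp_substitution[of "gamma_integrand c w"] gamma_integrand_complex(1)[OF assms]
    by (simp add: sub ind)
  show "integral\<^sup>L lborel (log_gamma_integrand c w) = Gamma w * c powr (- w)"
    using integral_exp_substitution[of "gamma_integrand c w"] gamma_integrand_complex[OF assms]
    by (simp add: sub ind)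
qed

text \<open>The logarithm of the modulus, Re w t - Re c exp t, has its maximum at t = ln (Re w / Re
  c); the inequality 1 + u \<le> exp u at the distance u from that point proves it.\<close>

lemma norm_log_gamma_integrand_le:
  assumes w: "Re w > 0" and c: "Re c > 0"
  shows "norm (log_gamma_integrand c w t) \<le> exp (Re w * ln (Re w / Re c) - Re w)"
proof -
  let ?s = "t - ln (Re w / Re c)"
  have "Re w * (1 + ?s) \<le> Re w * exp ?s"
    using w by (intro mult_left_mono) auto
  also have "\<dots> = Re c * exp t"
    using w c by (simp add: exp_diff)
  finally show ?thesis
    by (simp add: log_gamma_integrand_def algebra_simps)
qed

lemma fourier_log_gamma_integrand:
  assumes w: "Re w > 0" and c: "Re c > 0"
  shows "fourier (log_gamma_integrand c w) y
    = Gamma (w - \<i> * of_real y) * c powr (- (w - \<i> * of_real y))"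
proof -
  have "fourier (log_gamma_integrand c w) y = integral\<^sup>L lborel (log_gamma_integrand c (w - \<i> * of_real y))"
    unfolding fourier_def log_gamma_integrand_def
    by (intro Bochner_Integration.integral_cong refl) (simp add: algebra_simps flip: exp_add)
  then show ?thesis using log_gamma_integrand(2)[of "w - \<i> * of_real y" c] w c by simp
qed

text \<open>The power of c in the transform with exponent a contributes exp (i \<theta> a) exp
  (\<theta> y), the conjugated one exp (-i \<theta> b) exp (\<theta> y). Their product is the
  required weight up to the constant phase exp (i \<theta> (a - b)).\<close>

lemma
  assumes a: "Re a > 0" and b: "Re b > 0" and th: "\<bar>\<theta>\<bar> < pi / 2"
  defines "f \<equiv> \<lambda>y. of_real (exp (2 * \<theta> * y)) * (Gamma (a - \<i> * of_real y) * Gamma (b + \<i> * of_real y))"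
  shows integrable_exp_Gamma_Gamma: "integrable lborel f"
    and integral_exp_Gamma_Gamma: "integral\<^sup>L lborel f
      = of_real (2 * pi) * exp (\<i> * of_real \<theta> * (b - a)) * Gamma (a + b) * of_real (2 * cos \<theta>) powr (- (a + b))"
proof -
  define c where "c = exp (- (\<i> * of_real \<theta>))"
  have Rec: "Re c = cos \<theta>" by (simp add: c_def Re_exp)
  have cos: "cos \<theta> > 0" using th by (intro cos_gt_zero_pi) auto
  have c: "Re c > 0" using cos Rec by simp
  have Lnc: "Ln c = - (\<i> * of_real \<theta>)"
    unfolding c_def using th pi_gt_zero by (intro Ln_exp) (auto simp: abs_if split: if_splits)
  have c_powr: "c powr u = exp (- (u * \<i> * of_real \<theta>))" for u
    using c by (auto simp: powr_def Lnc mult_ac)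
  have b': "Re (cnj b) > 0" using b by simp
  \<comment> \<open>The second exponent is \<open>cnj b\<close> so that conjugating its transform
    yields \<Gamma>(b + i y).\<close>
  let ?F = "log_gamma_integrand c a" and ?G = "log_gamma_integrand c (cnj b)"
  note hyps = log_gamma_integrand(1)[OF a c] norm_log_gamma_integrand_le[OF a c]
    continuous_log_gamma_integrand[of c a] log_gamma_integrand(1)[OF b' c]
    norm_log_gamma_integrand_le[OF b' c] continuous_log_gamma_integrand[of c "cnj b"]
  have f_eq: "f y = exp (\<i> * of_real \<theta> * (b - a)) * (fourier ?F y * cnj (fourier ?G y))" for y
  proof -
    have "fourier ?F y * cnj (fourier ?G y)
        = (Gamma (a - \<i> * of_real y) * Gamma (b + \<i> * of_real y))
          * (exp ((a - \<i> * of_real y) * \<i> * of_real \<theta>) * exp (- ((b + \<i> * of_real y) * \<i> * of_real \<theta>)))"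
      unfolding fourier_log_gamma_integrand[OF a c] fourier_log_gamma_integrand[OF b' c] c_powr
      by (simp add: cnj_Gamma exp_cnj algebra_simps)
    also have "exp (\<i> * of_real \<theta> * (b - a)) * \<dots> = (Gamma (a - \<i> * of_real y) * Gamma (b + \<i> * of_real y))
          * exp (\<i> * of_real \<theta> * (b - a) + ((a - \<i> * of_real y) * \<i> * of_real \<theta> - (b + \<i> * of_real y) * \<i> * of_real \<theta>))"
      by (simp add: exp_add exp_diff exp_minus divide_inverse mult_ac)
    also have "\<i> * of_real \<theta> * (b - a) + ((a - \<i> * of_real y) * \<i> * of_real \<theta> - (b + \<i> * of_real y) * \<i> * of_real \<theta>)
        = complex_of_real (2 * \<theta> * y)"
      by (simp add: algebra_simps)
    finally show ?thesis by (simp add: f_def flip: exp_of_real)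
  qed
  show "integrable lborel f"
    unfolding f_eq[abs_def] by (intro integrable_mult_right Parseval_fourier(1)[OF hyps])
  have "integral\<^sup>L lborel f = exp (\<i> * of_real \<theta> * (b - a)) * (of_real (2 * pi) * (\<integral>t. ?F t * cnj (?G t) \<partial>lborel))"
    unfolding f_eq[abs_def] integral_mult_right_zero Parseval_fourier(2)[OF hyps] ..
  also have "(\<integral>t. ?F t * cnj (?G t) \<partial>lborel) = integral\<^sup>L lborel (log_gamma_integrand (of_real (2 * cos \<theta>)) (a + b))"
  proof (intro Bochner_Integration.integral_cong refl)
    fix t
    \<comment> \<open>In the product of ?F with the conjugate of ?G the exponents add to a + b and
      the rates to this positive real number.\<close>
    have "c + cnj c = of_real (2 * cos \<theta>)" by (simp add: complex_add_cnj Rec)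
    then show "?F t * cnj (?G t) = log_gamma_integrand (of_real (2 * cos \<theta>)) (a + b) t"
      by (simp only: log_gamma_integrand_def exp_cnj exp_add[symmetric] complex_cnj_diff complex_cnj_mult
          complex_cnj_cnj complex_cnj_complex_of_real \<open>c + cnj c = _\<close>[symmetric])
         (simp add: algebra_simps)
  qed
  also have "\<dots> = Gamma (a + b) * of_real (2 * cos \<theta>) powr (- (a + b))"
    using a b cos by (intro log_gamma_integrand(2)) auto
  finally show "integral\<^sup>L lborel f = of_real (2 * pi) * exp (\<i> * of_real \<theta> * (b - a)) * Gamma (a + b)
      * of_real (2 * cos \<theta>) powr (- (a + b))"
    by (simp add: mult_ac)
qed

subsection \<open>The Meixner distribution\<close>

lemma integral_lborel_affine:
  fixes f :: "real \<Rightarrow> complex"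
  assumes m: "m > 0"
  shows "(\<integral>x. f (x / m + k) \<partial>lborel) = of_real m * integral\<^sup>L lborel f"
proof -
  have "integral\<^sup>L lborel f = \<bar>1 / m\<bar> *\<^sub>R (\<integral>x. f (k + (1 / m) * x) \<partial>lborel)"
    by (rule lborel_integral_real_affine) (use m in simp)
  then show ?thesis using m by (simp add: scaleR_conv_of_real add.commute)
qed

lemma integrable_lborel_affine:
  fixes f :: "real \<Rightarrow> complex"
  assumes m: "m > 0" and f: "integrable lborel f"
  shows "integrable lborel (\<lambda>x. f (x / m + k))"
  using lborel_integrable_real_affine[OF f, of "1 / m" k] m by (simp add: add.commute)

lemma Gamma_right_half_plane_nonzero: "Re w > 0 \<Longrightarrow> Gamma w \<noteq> (0 :: complex)"
  by (auto simp: Gamma_eq_zero_iff elim!: nonpos_Ints_cases)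

lemma Gamma_right_half_plane_plus1: "Re w > 0 \<Longrightarrow> Gamma (w + 1) = w * Gamma (w :: complex)"
  by (rule Gamma_plus1) (auto elim!: nonpos_Ints_cases)

lemma lborel_restrict_UNIV: "restrict_space lborel UNIV = lborel"
  by (rule measure_eqI) (auto simp: emeasure_restrict_space)

text \<open>\<Gamma> is the pointwise inverse of the entire function \<open>rGamma\<close>, so the
  poles cause no trouble.\<close>

lemma borel_measurable_Gamma [measurable]: "(Gamma :: complex \<Rightarrow> complex) \<in> borel_measurable borel"
proof -
  have [measurable]: "(rGamma :: complex \<Rightarrow> complex) \<in> borel_measurable borel"
    by (intro borel_measurable_continuous_onI continuous_intros)
  show ?thesis unfolding Gamma_def by measurable
qed

text \<open>In the variable y = x / m + \<kappa> the Gamma arguments of density and kernel become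
  s/2 + i y and s/2 - i y, the latter shifted by z / \<beta>.\<close>

locale meixner =
  fixes \<alpha> \<beta> :: complex and \<sigma> \<eta> \<theta> s m \<kappa> :: real
  assumes sigma: "\<sigma> > 0" and meixner: "meixner_case \<alpha> \<beta>"
    and eta_def: "\<eta> = par_eta \<alpha> \<beta>"
    and theta_def: "\<theta> = pi / 2 - Arg \<alpha>"
    and s_def: "s = \<sigma> / \<eta>"
    and m_def: "m = 2 * Im \<alpha>"
    and kappa_def: "\<kappa> = \<sigma> * Re \<alpha> / (\<eta> * m)"
begin

lemma alpha: "Im \<alpha> > 0" "Re \<alpha> \<ge> 0" "\<beta> = cnj \<alpha>" "\<alpha> \<noteq> 0" "\<beta> \<noteq> 0"
  using meixner by (auto simp: meixner_case_def)

lemma m_pos: "m > 0"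
  using alpha by (simp add: m_def)

lemma eta_cmod: "\<eta> = (cmod \<alpha>)\<^sup>2"
  unfolding cmod_power2 by (simp add: eta_def par_eta_def alpha(3) power2_eq_square)

lemma eta_pos: "\<eta> > 0"
  using alpha(4) by (simp add: eta_cmod)

lemma eta_eq: "of_real \<eta> = \<alpha> * \<beta>"
  by (simp add: eta_cmod alpha(3) complex_norm_square del: of_real_power)

lemma s_pos: "s > 0"
  using sigma eta_pos by (simp add: s_def)

lemma not_cases: "\<not> gamma_case \<alpha> \<beta>" "\<not> neg_binomial_case \<alpha> \<beta>"
  using alpha(1) by (auto simp: gamma_case_def neg_binomial_case_def)

lemma Arg_bounds: "0 < Arg \<alpha>" "Arg \<alpha> \<le> pi / 2"
proof -
  show "0 < Arg \<alpha>" using alpha(1) Arg_lt_pi[of \<alpha>] by simp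
  show "Arg \<alpha> \<le> pi / 2" using alpha Arg_Re_nonneg[of \<alpha>] by auto
qed

lemma theta_bound: "\<bar>\<theta>\<bar> < pi / 2"
  using Arg_bounds by (auto simp: theta_def)

lemma cos_theta_pos: "cos \<theta> > 0"
  using theta_bound by (intro cos_gt_zero_pi) auto

text \<open>Here cos \<theta> = Im \<alpha> / \<bar>\<alpha>\<bar> and exp (i \<theta>) = i
  \<bar>\<alpha>\<bar> / \<alpha>. The product is the factor that the power and the exponential in
  \<open>K\<close> gain under z -> z + \<beta>.\<close>

lemma cos_theta: "of_real (2 * cos \<theta>) * exp (\<i> * of_real \<theta>) = 1 - \<beta> / \<alpha>"
proof -
  have a: "\<alpha> = of_real (cmod \<alpha>) * exp (\<i> * of_real (Arg \<alpha>))"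
    using alpha(4) by (rule Arg_eq)
  have "cos \<theta> = sin (Arg \<alpha>)" by (simp add: theta_def cos_sin_eq)
  also have "\<dots> = Im \<alpha> / cmod \<alpha>"
    using alpha(4) by (subst (2) a) (simp add: Im_exp)
  finally have c: "cos \<theta> = Im \<alpha> / cmod \<alpha>" .
  have "exp (\<i> * of_real \<theta>) = exp (\<i> * of_real pi / 2) / exp (\<i> * of_real (Arg \<alpha>))"
    by (simp add: theta_def algebra_simps flip: exp_diff)
  also have "exp (\<i> * of_real pi / 2) = \<i>"
    using cis_pi_half by (simp add: cis_conv_exp)
  also have "exp (\<i> * of_real (Arg \<alpha>)) = \<alpha> / of_real (cmod \<alpha>)"
    using alpha(4) by (subst (2) a) simp
  finally have "of_real (2 * cos \<theta>) * exp (\<i> * of_real \<theta>) = 2 * \<i> * of_real (Im \<alpha>) / \<alpha>"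
    using alpha(4) by (simp add: c field_simps)
  also have "2 * \<i> * of_real (Im \<alpha>) = \<alpha> - \<beta>"
    by (simp add: alpha(3) complex_eq_iff)
  finally show ?thesis using alpha(4) by (simp add: field_simps)
qed

text \<open>Since z / \<beta> = \<alpha> z / \<eta>, the domain is the set where s/2 + z / \<beta>,
  the Gamma exponent in \<open>K\<close>, lies in the right half-plane.\<close>

lemma D_iff: "z \<in> D_set \<alpha> \<beta> \<sigma> \<longleftrightarrow> Re (z / \<beta>) > - s / 2"
proof -
  have "z / \<beta> = \<alpha> * z / of_real \<eta>"
    using alpha by (simp add: eta_eq)
  then have "Re (z / \<beta>) = Re (\<alpha> * z) / \<eta>"
    by (metis Re_divide_of_real)
  then have "Re (z / \<beta>) > - s / 2 \<longleftrightarrow> Re (\<alpha> * z) > - \<sigma> / 2"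
    using eta_pos by (simp only: s_def) (simp add: field_simps del: times_complex.sel)
  moreover have "cmod \<alpha> = cmod \<beta>" by (simp add: alpha(3))
  ultimately show ?thesis
    by (simp add: D_set_def)
qed

definition K :: "complex \<Rightarrow> real \<Rightarrow> complex" where
  "K z x = of_real (2 * cos \<theta>) powr (z / \<beta>)
     * (Gamma (of_real s) / Gamma (of_real s + z / \<beta>))
     * exp (\<i> * of_real \<theta> * (z / \<beta>))
     * (Gamma (of_real (s / 2) + z / \<beta> - \<i> * of_real (x / m + \<kappa>))
        / Gamma (of_real (s / 2) - \<i> * of_real (x / m + \<kappa>)))"

lemma Gamma_argument:
  "- (\<i> * of_real x / of_real (2 * Im \<alpha>)) - \<i> * of_real \<sigma> * \<alpha> / of_real (2 * \<eta> * Im \<alpha>)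
    = of_real (s / 2) - \<i> * of_real (x / m + \<kappa>)"
  using eta_pos alpha(1)
  by (simp add: complex_eq_iff s_def m_def kappa_def Re_divide Im_divide power2_eq_square field_simps)

lemma Gamma_argument_cnj:
  "\<i> * of_real x / of_real (2 * Im \<alpha>) + \<i> * of_real \<sigma> * \<beta> / of_real (2 * \<eta> * Im \<alpha>)
    = of_real (s / 2) + \<i> * of_real (x / m + \<kappa>)"
  using eta_pos alpha(1)
  by (simp add: complex_eq_iff s_def m_def kappa_def alpha(3) Re_divide Im_divide power2_eq_square field_simps)

lemma K_formula:
  "K z x = of_real (2 * cos (pi / 2 - Arg \<alpha>)) powr (\<alpha> * z / of_real \<eta>)
     * (Gamma (of_real (\<sigma> / \<eta>)) / Gamma ((of_real \<sigma> + \<alpha> * z) / of_real \<eta>))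
     * exp (\<i> * of_real (pi / 2 - Arg \<alpha>) * \<alpha> * z / of_real \<eta>)
     * (Gamma (- (\<i> * of_real x / of_real (2 * Im \<alpha>))
               - \<i> * of_real \<sigma> * \<alpha> / of_real (2 * \<eta> * Im \<alpha>)
               + \<alpha> * z / of_real \<eta>)
        / Gamma (- (\<i> * of_real x / of_real (2 * Im \<alpha>))
                 - \<i> * of_real \<sigma> * \<alpha> / of_real (2 * \<eta> * Im \<alpha>)))"
proof -
  have "\<alpha> * z / of_real \<eta> = z / \<beta>" using alpha by (simp add: eta_eq)
  moreover have "(of_real \<sigma> + \<alpha> * z) / of_real \<eta> = of_real s + z / \<beta>"
    using alpha by (simp add: s_def eta_eq field_simps)
  moreover have "\<i> * of_real (pi / 2 - Arg \<alpha>) * \<alpha> * z / of_real \<eta> = \<i> * of_real \<theta> * (z / \<beta>)"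
    using alpha by (simp add: theta_def eta_eq)
  ultimately show ?thesis
    by (simp only: K_def Gamma_argument) (simp only: theta_def s_def diff_add_eq)
qed

lemma K_0: "K 0 x = 1"
  using Gamma_right_half_plane_nonzero[of "of_real s"] Gamma_right_half_plane_nonzero[of "of_real (s / 2) - \<i> * of_real (x / m + \<kappa>)"] s_pos
    cos_theta_pos by (simp add: K_def)

text \<open>The functional equation of \<Gamma> in the numerator of \<open>K\<close> releases c + a,
  which is affine in x; in the denominator it releases s + a, which the coefficient (\<alpha> z +
  \<sigma>) / \<beta> = \<alpha> (s + a) cancels.\<close>

lemma K_shift:
  assumes z: "z \<in> D_set \<alpha> \<beta> \<sigma>"
  shows "of_real x * K z x
    = (\<alpha> * z + of_real \<sigma>) / \<beta> * K (z + \<beta>) x - ((\<alpha> - \<beta>) * z + of_real \<sigma>) / \<beta> * K z x"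
proof -
  define a where "a = z / \<beta>"
  define c where "c = of_real (s / 2) - \<i> * of_real (x / m + \<kappa>)"
  have Rea: "Re a > - s / 2" using z by (simp add: D_iff a_def)
  have a1: "(z + \<beta>) / \<beta> = a + 1" using alpha by (simp add: a_def field_simps)
  have pos: "Re (of_real s + a) > 0" "Re (c + a) > 0" using Rea s_pos by (auto simp: c_def)
  have "K (z + \<beta>) x * (of_real s + a) = (1 - \<beta> / \<alpha>) * (c + a) * K z x"
  proof -
    have 1: "of_real (2 * cos \<theta>) powr (a + 1) = of_real (2 * cos \<theta>) powr a * of_real (2 * cos \<theta>)"
      using cos_theta_pos by (simp add: powr_add)
    have 2: "Gamma (of_real s + (a + 1)) = (of_real s + a) * Gamma (of_real s + a)"
      using Gamma_right_half_plane_plus1[OF pos(1)] by (simp add: add.assoc)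
    have 3: "Gamma (of_real (s / 2) + (a + 1) - \<i> * of_real (x / m + \<kappa>)) = (c + a) * Gamma (c + a)"
      using Gamma_right_half_plane_plus1[OF pos(2)] by (simp add: c_def algebra_simps)
    have 4: "of_real (s / 2) + a - \<i> * of_real (x / m + \<kappa>) = c + a"
      by (simp add: c_def)
    have 5: "exp (\<i> * of_real \<theta> * (a + 1)) = exp (\<i> * of_real \<theta> * a) * exp (\<i> * of_real \<theta>)"
      by (simp add: distrib_left exp_add)
    have sa: "of_real s + a \<noteq> 0" "Gamma (of_real s + a) \<noteq> 0" using pos(1) Gamma_right_half_plane_nonzero[OF pos(1)] by auto
    have Y: "Gamma (of_real s) / Gamma (of_real s + a)
        = Gamma (of_real s) / ((of_real s + a) * Gamma (of_real s + a)) * (of_real s + a)"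
      using sa by simp
    show ?thesis
      unfolding K_def a1 a_def[symmetric] c_def[symmetric] 1 2 3 4 5 cos_theta[symmetric]
      unfolding Y by (simp only: mult_ac times_divide_eq_left times_divide_eq_right)
  qed
  moreover have "(\<alpha> * z + of_real \<sigma>) / \<beta> = \<alpha> * (of_real s + a)"
    using alpha by (simp add: a_def s_def eta_eq field_simps)
  ultimately have "(\<alpha> * z + of_real \<sigma>) / \<beta> * K (z + \<beta>) x = \<alpha> * (1 - \<beta> / \<alpha>) * (c + a) * K z x"
    by (simp add: mult_ac)
  also have "\<alpha> * (1 - \<beta> / \<alpha>) * (c + a) = of_real x + ((\<alpha> - \<beta>) * z + of_real \<sigma>) / \<beta>"
  proof -
    have "\<alpha> * (1 - \<beta> / \<alpha>) = \<i> * of_real m"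
      using alpha(4) by (simp add: field_simps) (simp add: m_def alpha(3) complex_eq_iff)
    moreover have ab: "\<alpha> - \<beta> = \<i> * of_real m"
      by (simp add: m_def alpha(3) complex_eq_iff)
    moreover have "\<i> * of_real m * c = of_real x + of_real \<sigma> / \<beta>"
    proof -
      have "of_real \<sigma> / \<beta> = of_real \<sigma> * \<alpha> / of_real \<eta>" using alpha by (simp add: eta_eq)
      then show ?thesis using m_pos eta_pos
        by (simp add: complex_eq_iff c_def s_def kappa_def Re_divide_of_real Im_divide_of_real field_simps)
           (simp add: m_def)
    qed
    ultimately have "\<alpha> * (1 - \<beta> / \<alpha>) * (c + a) = of_real x + of_real \<sigma> / \<beta> + (\<alpha> - \<beta>) * a"
      by (simp only: distrib_left)
    then show ?thesis by (simp add: a_def add_divide_distrib)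
  qed
  finally show ?thesis by (simp add: algebra_simps)
qed

lemma K_measurable [measurable]: "K z \<in> borel_measurable borel"
  unfolding K_def[abs_def] by measurable

text \<open>\<open>meixner_const\<close> without its exponential factor exp (2 \<theta> \<kappa>),
  which moves into the weight in the variable x / m + \<kappa>.\<close>

definition C :: real where
  "C = (2 * cos \<theta>) powr s / (2 * pi * m * Gamma s)"

lemma density_eq:
  "meixner_density \<alpha> \<beta> \<sigma> x
    = C * (exp (2 * \<theta> * (x / m + \<kappa>)) * (cmod (Gamma (of_real (s / 2) + \<i> * of_real (x / m + \<kappa>))))\<^sup>2)"
proof -
  have "exp (\<theta> * \<sigma> * Re \<alpha> / (Im \<alpha> * \<eta>)) * exp (\<theta> * x / Im \<alpha>) = exp (2 * \<theta> * (x / m + \<kappa>))"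
    using alpha(1) eta_pos by (simp add: m_def kappa_def field_simps flip: exp_add)
  then show ?thesis
    unfolding meixner_density_def meixner_const_def Let_def eta_def[symmetric] theta_def[symmetric]
      s_def[symmetric] Gamma_argument_cnj C_def
    by (simp add: m_def mult_ac)
qed

lemma C_nonneg: "C \<ge> 0"
  using m_pos s_pos by (simp add: C_def Gamma_real_nonneg)

lemma density_measurable [measurable]: "meixner_density \<alpha> \<beta> \<sigma> \<in> borel_measurable borel"
  unfolding density_eq[abs_def] by measurable

lemma mu_eq: "mu \<alpha> \<beta> \<sigma> = density lborel (\<lambda>x. ennreal (meixner_density \<alpha> \<beta> \<sigma> x))"
  by (simp add: mu_def X_set_def not_cases lborel_restrict_UNIV)

lemma density_nonneg: "meixner_density \<alpha> \<beta> \<sigma> x \<ge> 0"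
  using C_nonneg by (simp add: density_eq)

text \<open>The density times \<open>K z\<close>, and the modulus squared of \<open>K z\<close>
  times the density, are both reduced to this integrand, with different b.\<close>

definition Q :: "complex \<Rightarrow> complex \<Rightarrow> real \<Rightarrow> complex" where
  "Q a b y = of_real (exp (2 * \<theta> * y)) * (Gamma (a - \<i> * of_real y) * Gamma (b + \<i> * of_real y))"

lemma integrable_Q: "Re a > 0 \<Longrightarrow> Re b > 0 \<Longrightarrow> integrable lborel (\<lambda>x. Q a b (x / m + \<kappa>))"
  unfolding Q_def by (intro integrable_lborel_affine[OF m_pos] integrable_exp_Gamma_Gamma theta_bound)

lemma integral_Q:
  "Re a > 0 \<Longrightarrow> Re b > 0 \<Longrightarrow> (\<integral>x. Q a b (x / m + \<kappa>) \<partial>lborel)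
    = of_real m * (of_real (2 * pi) * exp (\<i> * of_real \<theta> * (b - a)) * Gamma (a + b)
        * of_real (2 * cos \<theta>) powr (- (a + b)))"
  unfolding integral_lborel_affine[OF m_pos]
  by (intro arg_cong2[of _ _ _ _ times] refl) (unfold Q_def, rule integral_exp_Gamma_Gamma[OF _ _ theta_bound])

definition A :: "complex \<Rightarrow> complex" where
  "A a = of_real (2 * cos \<theta>) powr a * (Gamma (of_real s) / Gamma (of_real s + a)) * exp (\<i> * of_real \<theta> * a)"

lemma K_eq:
  "K z x = A (z / \<beta>) * (Gamma (of_real (s / 2) + z / \<beta> - \<i> * of_real (x / m + \<kappa>))
        / Gamma (of_real (s / 2) - \<i> * of_real (x / m + \<kappa>)))"
  by (simp add: K_def A_def)

lemma cmod_Gamma_cnj: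
  "cmod (Gamma (of_real (s / 2) + \<i> * of_real y)) = cmod (Gamma (of_real (s / 2) - \<i> * of_real y))"
proof -
  have "Gamma (of_real (s / 2) + \<i> * of_real y) = cnj (Gamma (of_real (s / 2) - \<i> * of_real y))"
    by (simp add: cnj_Gamma)
  then show ?thesis by simp
qed

text \<open>The denominator of \<open>K z\<close> cancels one of the two conjugate Gamma factors of
  the density.\<close>

lemma density_K:
  "meixner_density \<alpha> \<beta> \<sigma> x *\<^sub>R K z x
    = of_real C * A (z / \<beta>) * Q (of_real (s / 2) + z / \<beta>) (of_real (s / 2)) (x / m + \<kappa>)"
proof -
  define y where "y = x / m + \<kappa>"
  let ?g = "Gamma (of_real (s / 2) - \<i> * of_real y)"
  have "?g \<noteq> 0" using s_pos by (intro Gamma_right_half_plane_nonzero) simp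
  moreover have "complex_of_real ((cmod (Gamma (of_real (s / 2) + \<i> * of_real y)))\<^sup>2)
      = ?g * Gamma (of_real (s / 2) + \<i> * of_real y)"
    unfolding complex_norm_square by (simp add: cnj_Gamma mult.commute)
  ultimately show ?thesis
    unfolding density_eq K_eq Q_def y_def[symmetric] scaleR_conv_of_real of_real_mult
    by (simp del: of_real_power)
qed

text \<open>Both Gamma factors of the density cancel, leaving \<Gamma>(a - i y) times its conjugate
  with a = s/2 + z / \<beta>.\<close>

lemma density_K_square:
  "meixner_density \<alpha> \<beta> \<sigma> x *\<^sub>R (cmod (K z x))\<^sup>2
    = C * (cmod (A (z / \<beta>)))\<^sup>2
      * norm (Q (of_real (s / 2) + z / \<beta>) (cnj (of_real (s / 2) + z / \<beta>)) (x / m + \<kappa>))"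
proof -
  define y where "y = x / m + \<kappa>"
  define a where "a = of_real (s / 2) + z / \<beta>"
  let ?g = "Gamma (of_real (s / 2) - \<i> * of_real y)"
  have "?g \<noteq> 0" using s_pos by (intro Gamma_right_half_plane_nonzero) simp
  moreover have "Gamma (cnj a + \<i> * of_real y) = cnj (Gamma (a - \<i> * of_real y))"
    by (simp add: cnj_Gamma)
  ultimately show ?thesis
    unfolding density_eq K_eq Q_def y_def[symmetric] a_def[symmetric] cmod_Gamma_cnj
    by (simp add: norm_mult norm_divide power_mult_distrib power_divide power2_eq_square)
qed

lemma K_L2:
  assumes z: "z \<in> D_set \<alpha> \<beta> \<sigma>"
  shows "K z \<in> L2 (mu \<alpha> \<beta> \<sigma>)"
proof -
  have "Re (of_real (s / 2) + z / \<beta>) > 0" "Re (cnj (of_real (s / 2) + z / \<beta>)) > 0"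
    unfolding cnj.sel using z by (simp_all add: D_iff)
  then have "integrable lborel (\<lambda>x. meixner_density \<alpha> \<beta> \<sigma> x *\<^sub>R (cmod (K z x))\<^sup>2)"
    unfolding density_K_square by (intro integrable_mult_right integrable_norm integrable_Q)
  then have "integrable (mu \<alpha> \<beta> \<sigma>) (\<lambda>x. (cmod (K z x))\<^sup>2)"
    unfolding mu_eq by (subst integrable_density) (auto simp: density_nonneg)
  moreover have "K z \<in> borel_measurable (mu \<alpha> \<beta> \<sigma>)"
    unfolding mu_eq by simp
  ultimately show ?thesis by (simp add: L2_def)
qed

text \<open>The two exponents s/2 + z / \<beta> and s/2 add up to s + z / \<beta>, and the constant
  \<open>C\<close> times \<open>A (z / \<beta>)\<close> is the reciprocal of the value that
  \<open>integral_Q\<close> assigns to them.\<close>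

lemma K_integral:
  assumes z: "z \<in> D_set \<alpha> \<beta> \<sigma>"
  shows "(\<integral>x. K z x \<partial>mu \<alpha> \<beta> \<sigma>) = 1"
proof -
  define a where "a = z / \<beta>"
  have Re: "Re (of_real (s / 2) + a) > 0" "Re (of_real s + a) > 0"
    using z s_pos by (auto simp: D_iff a_def)
  let ?p = "of_real (2 * cos \<theta>) :: complex"
  have p: "?p \<noteq> 0" using cos_theta_pos by simp
  have "(\<integral>x. K z x \<partial>mu \<alpha> \<beta> \<sigma>)
      = (\<integral>x. of_real C * A a * Q (of_real (s / 2) + a) (of_real (s / 2)) (x / m + \<kappa>) \<partial>lborel)"
    unfolding mu_eq a_def by (subst integral_density) (auto simp: density_nonneg density_K)
  also have "\<dots> = of_real C * A a * (of_real m * (of_real (2 * pi) * exp (\<i> * of_real \<theta> * (of_real (s / 2) - (of_real (s / 2) + a)))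
        * Gamma (of_real (s / 2) + a + of_real (s / 2)) * ?p powr (- (of_real (s / 2) + a + of_real (s / 2)))))"
    unfolding integral_mult_right_zero using Re s_pos by (subst integral_Q) simp_all
  also have "of_real (s / 2) - (of_real (s / 2) + a) = - a" by simp
  also have "of_real (s / 2) + a + of_real (s / 2) = of_real s + a"
    by (simp add: field_simps)
  also have "of_real C = ?p powr of_real s / (of_real (2 * pi) * of_real m * Gamma (of_real s))"
    using cos_theta_pos by (simp add: C_def Gamma_complex_of_real flip: powr_of_real)
  also have "?p powr (- (of_real s + a)) = 1 / (?p powr of_real s * ?p powr a)"
    using p by (simp only: powr_minus powr_add) (simp add: field_simps)
  also have "exp (\<i> * of_real \<theta> * - a) = 1 / exp (\<i> * of_real \<theta> * a)"
    by (simp add: exp_minus field_simps)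
  finally show ?thesis
    using m_pos p Gamma_right_half_plane_nonzero[OF Re(2)] Gamma_right_half_plane_nonzero[of "of_real s"] s_pos pi_gt_zero by (simp add: A_def)
qed

sublocale kernel_family \<alpha> \<beta> \<sigma> K
proof
  show "0 < \<sigma>" by (rule sigma)
  show "0 < par_eta \<alpha> \<beta>" "complex_of_real (par_eta \<alpha> \<beta>) = \<alpha> * \<beta>"
    using eta_pos eta_eq by (simp_all add: eta_def)
  show "complex_of_real (par_lambda \<alpha> \<beta>) = \<alpha> + \<beta>"
    by (simp add: par_lambda_def alpha(3) complex_eq_iff)
  have "par_l \<alpha> \<sigma> = 0" using alpha(1) by (simp add: par_l_def)
  then show "(of_real x - of_real (par_l \<alpha> \<sigma>)) * K z x
      = (\<alpha> * z + of_real \<sigma>) / \<beta> * K (z + \<beta>) x - ((\<alpha> - \<beta>) * z + of_real \<sigma>) / \<beta> * K z x"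
    if "z \<in> D_set \<alpha> \<beta> \<sigma>" for x z
    using K_shift[OF that] by simp
qed (simp_all add: K_L2 K_integral K_0)

end

subsection \<open>The gamma distribution\<close>

locale gamma_weight =
  fixes \<alpha> \<beta> :: complex and \<sigma> a s :: real
  assumes sigma: "\<sigma> > 0" and gamma: "gamma_case \<alpha> \<beta>"
    and a_def: "a = Re \<alpha>"
    and s_def: "s = \<sigma> / a\<^sup>2"
begin

lemma a_pos: "a > 0" and alpha: "\<alpha> = of_real a" and beta: "\<beta> = of_real a"
  using gamma by (auto simp: gamma_case_def a_def complex_eq_iff)

lemma s_pos: "s > 0"
  using sigma a_pos by (simp add: s_def)

lemma D_iff: "z \<in> D_set \<alpha> \<beta> \<sigma> \<longleftrightarrow> Re (z / of_real a) > - s / 2"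
  using a_pos by (simp add: D_set_def alpha beta s_def field_simps power2_eq_square)

definition K :: "complex \<Rightarrow> real \<Rightarrow> complex" where
  "K z x = Gamma (of_real s) / Gamma (of_real s + z / of_real a) * (of_real x / of_real a) powr (z / of_real a)"

lemma K_formula:
  "K z x = Gamma (of_real \<sigma> / \<alpha>\<^sup>2) / Gamma ((\<alpha> * z + of_real \<sigma>) / \<alpha>\<^sup>2) * (of_real x / \<alpha>) powr (z / \<alpha>)"
proof -
  have "(\<alpha> * z + of_real \<sigma>) / \<alpha>\<^sup>2 = of_real s + z / of_real a"
    using a_pos by (simp add: alpha s_def field_simps power2_eq_square)
  moreover have "of_real \<sigma> / \<alpha>\<^sup>2 = of_real s"
    by (simp add: alpha s_def)
  ultimately show ?thesis by (simp add: K_def alpha)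
qed

lemma K_0: "x > 0 \<Longrightarrow> K 0 x = 1"
  using Gamma_right_half_plane_nonzero[of "of_real s"] s_pos a_pos by (simp add: K_def)

text \<open>For \<alpha> = \<beta> the coefficient of the unshifted kernel is \<sigma> / \<beta> =
  l, so it cancels the l on the left of the difference equation.\<close>

lemma K_shift:
  assumes z: "z \<in> D_set \<alpha> \<beta> \<sigma>" and x: "x > 0"
  shows "of_real x * K z x = (\<alpha> * z + of_real \<sigma>) / \<beta> * K (z + \<beta>) x"
proof -
  define w where "w = z / of_real a"
  have pos: "Re (of_real s + w) > 0" using z s_pos by (auto simp: D_iff w_def)
  have 1: "(z + \<beta>) / of_real a = w + 1" using a_pos by (simp add: w_def beta field_simps)
  have 2: "(of_real x / of_real a) powr (w + 1) = (of_real x / of_real a) powr w * (of_real x / of_real a)"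
    using x a_pos by (simp add: powr_add)
  have 3: "Gamma (of_real s + (w + 1)) = (of_real s + w) * Gamma (of_real s + w)"
    using Gamma_right_half_plane_plus1[OF pos] by (simp add: add.assoc)
  have 4: "(\<alpha> * z + of_real \<sigma>) / \<beta> = of_real a * (of_real s + w)"
    using a_pos by (simp add: alpha beta w_def s_def field_simps power2_eq_square)
  have "of_real s + w \<noteq> 0" using pos by (metis zero_complex.sel(1) less_irrefl)
  then show ?thesis
    unfolding K_def 1 w_def[symmetric] 2 3 4 using a_pos by simp
qed

lemma mu_eq: "mu \<alpha> \<beta> \<sigma> = density (restrict_space lborel {0<..}) (\<lambda>x. ennreal (gamma_density a \<sigma> x))"
  using gamma by (simp add: mu_def X_set_def a_def)

lemma density_eq:
  "gamma_density a \<sigma> x = 1 / Gamma s * a powr (- s) * (x powr (s - 1) * exp (- (x / a)))"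
  by (simp add: gamma_density_def Let_def s_def power2_eq_square)

lemma density_measurable [measurable]: "gamma_density a \<sigma> \<in> borel_measurable borel"
  unfolding density_eq[abs_def] by measurable

lemma density_nonneg: "gamma_density a \<sigma> x \<ge> 0"
  using s_pos by (simp add: density_eq Gamma_real_nonneg)

lemma K_measurable: "K z \<in> borel_measurable (restrict_space lborel {0<..})"
proof -
  have "(\<lambda>x. indicator {0<..} x *\<^sub>R K z x) \<in> borel_measurable borel"
    unfolding K_def[abs_def] using a_pos
    by (intro borel_measurable_continuous_on_indicator continuous_intros)
       (auto simp: complex_nonpos_Reals_iff)
  then show ?thesis
    by (subst borel_measurable_restrict_space_iff) auto
qed

lemma integral_mu:
  fixes f :: "real \<Rightarrow> 'b :: {banach, second_countable_topology}"
  assumes [measurable]: "f \<in> borel_measurable (restrict_space lborel {0<..})"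
  shows "integrable (mu \<alpha> \<beta> \<sigma>) f \<longleftrightarrow> integrable lborel (\<lambda>x. indicator {0<..} x *\<^sub>R gamma_density a \<sigma> x *\<^sub>R f x)"
    and "integral\<^sup>L (mu \<alpha> \<beta> \<sigma>) f = (\<integral>x. indicator {0<..} x *\<^sub>R gamma_density a \<sigma> x *\<^sub>R f x \<partial>lborel)"
proof -
  have [measurable]: "gamma_density a \<sigma> \<in> borel_measurable (restrict_space lborel {0<..})"
    by (intro measurable_restrict_space1) simp
  show "integrable (mu \<alpha> \<beta> \<sigma>) f \<longleftrightarrow> integrable lborel (\<lambda>x. indicator {0<..} x *\<^sub>R gamma_density a \<sigma> x *\<^sub>R f x)"
    unfolding mu_eq using density_nonneg
    by (subst integrable_density) (auto simp: integrable_restrict_space)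
  show "integral\<^sup>L (mu \<alpha> \<beta> \<sigma>) f = (\<integral>x. indicator {0<..} x *\<^sub>R gamma_density a \<sigma> x *\<^sub>R f x \<partial>lborel)"
    unfolding mu_eq using density_nonneg
    by (subst integral_density) (auto simp: integral_restrict_space)
qed

text \<open>Multiplying by \<open>K z\<close> shifts the exponent of the gamma density by z / a, so
  the normalization is Euler's integral at s + z / a.\<close>

lemma density_K:
  "indicator {0<..} x *\<^sub>R gamma_density a \<sigma> x *\<^sub>R K z x
    = of_real a powr (- (of_real s + z / of_real a)) / Gamma (of_real s + z / of_real a)
      * gamma_integrand (of_real (1 / a)) (of_real s + z / of_real a) x"
proof (cases "x > 0")
  case True
  define w where "w = z / of_real a"
  have 1: "complex_of_real (x powr (s - 1)) = of_real x powr (of_real s - 1)"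
    using True by (simp flip: powr_of_real)
  have 2: "complex_of_real (a powr (- s)) = of_real a powr (- of_real s)"
    using a_pos by (simp flip: powr_of_real)
  have 3: "(of_real x / of_real a) powr w = of_real x powr w * of_real a powr (- w)"
    using True a_pos by (simp add: powr_def Ln_of_real exp_diff ln_div algebra_simps flip: of_real_divide exp_add)
  have 4: "complex_of_real (exp (- (x / a))) = exp (- (of_real (1 / a) * of_real x))"
    by (simp flip: exp_of_real)
  have 5: "complex_of_real a powr (- (of_real s + w)) = of_real a powr (- of_real s) * of_real a powr (- w)"
    by (simp flip: powr_add)
  have 6: "complex_of_real x powr (of_real s + w - 1) = of_real x powr (of_real s - 1) * of_real x powr w"
    by (simp add: algebra_simps flip: powr_add)
  have "Gamma (complex_of_real s) \<noteq> 0" using s_pos by (intro Gamma_right_half_plane_nonzero) simp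
  then show ?thesis
    using True unfolding w_def[symmetric] gamma_integrand_def K_def density_eq scaleR_conv_of_real of_real_mult
      1 2 3 4 5 6
    by (simp add: Gamma_complex_of_real)
qed (simp add: gamma_integrand_def)

text \<open>Under the norm only the real part of the exponent counts: s + 2 Re (z / a), which is
  positive precisely on the domain.\<close>

lemma density_K_square:
  "indicator {0<..} x *\<^sub>R gamma_density a \<sigma> x *\<^sub>R (cmod (K z x))\<^sup>2
    = 1 / Gamma s * a powr (- s) * (cmod (Gamma (of_real s) / Gamma (of_real s + z / of_real a)))\<^sup>2
      * a powr (- 2 * Re (z / of_real a))
      * norm (gamma_integrand (of_real (1 / a)) (of_real s + 2 * (z / of_real a)) x)"
proof (cases "x > 0")
  case True
  define w where "w = z / of_real a"
  have "cmod ((of_real x / of_real a) powr w) = x powr Re w * a powr (- Re w)"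
    using True a_pos norm_powr_real_powr[of "of_real (x / a)" w]
    by (simp add: powr_divide powr_minus field_simps)
  moreover have "(t powr r)\<^sup>2 = t powr (2 * r)" for t r :: real
    by (simp add: power2_eq_square flip: powr_add)
  ultimately have "(cmod ((of_real x / of_real a) powr w))\<^sup>2 = x powr (2 * Re w) * a powr (- 2 * Re w)"
    by (simp add: power_mult_distrib)
  moreover have "x powr (s + 2 * Re w - 1) = x powr (s - 1) * x powr (2 * Re w)"
    by (simp add: algebra_simps flip: powr_add)
  ultimately show ?thesis
    using True unfolding w_def[symmetric] norm_gamma_integrand K_def density_eq norm_mult power_mult_distrib
    by (simp add: mult_ac)
qed (simp add: gamma_integrand_def)

lemma K_L2:
  assumes z: "z \<in> D_set \<alpha> \<beta> \<sigma>"
  shows "K z \<in> L2 (mu \<alpha> \<beta> \<sigma>)"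
proof -
  note [measurable] = K_measurable
  have "Re (of_real s + 2 * (z / of_real a)) > 0" using z by (simp add: D_iff)
  then have "integrable lborel (\<lambda>x. indicator {0<..} x *\<^sub>R gamma_density a \<sigma> x *\<^sub>R (cmod (K z x))\<^sup>2)"
    unfolding density_K_square using a_pos
    by (intro integrable_mult_right integrable_norm gamma_integrand_complex) simp_all
  then have "integrable (mu \<alpha> \<beta> \<sigma>) (\<lambda>x. (cmod (K z x))\<^sup>2)"
    by (subst integral_mu) auto
  moreover have "K z \<in> borel_measurable (mu \<alpha> \<beta> \<sigma>)"
    unfolding mu_eq by simp
  ultimately show ?thesis by (simp add: L2_def)
qed

lemma K_integral:
  assumes z: "z \<in> D_set \<alpha> \<beta> \<sigma>"
  shows "(\<integral>x. K z x \<partial>mu \<alpha> \<beta> \<sigma>) = 1"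
proof -
  define u where "u = of_real s + z / of_real a"
  have pos: "Re u > 0" using z s_pos by (auto simp: D_iff u_def)
  have inv: "of_real (1 / a) powr (- u) = of_real a powr u"
    using a_pos by (simp add: powr_def Ln_of_real ln_div flip: of_real_inverse of_real_divide)
  have "(\<integral>x. K z x \<partial>mu \<alpha> \<beta> \<sigma>)
      = of_real a powr (- u) / Gamma u * (Gamma u * of_real (1 / a) powr (- u))"
    unfolding integral_mu(2)[OF K_measurable] density_K u_def[symmetric] integral_mult_right_zero
    using pos a_pos by (subst gamma_integrand_complex(2)) simp_all
  also have "\<dots> = 1"
    unfolding inv using a_pos Gamma_right_half_plane_nonzero[OF pos] by (simp add: powr_minus)
  finally show ?thesis .
qed

sublocale kernel_family \<alpha> \<beta> \<sigma> K
proof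
  show "0 < \<sigma>" by (rule sigma)
  show "0 < par_eta \<alpha> \<beta>" "complex_of_real (par_eta \<alpha> \<beta>) = \<alpha> * \<beta>"
    "complex_of_real (par_lambda \<alpha> \<beta>) = \<alpha> + \<beta>"
    using a_pos by (simp_all add: par_eta_def par_lambda_def alpha beta)
  have "of_real (par_l \<alpha> \<sigma>) = of_real \<sigma> / \<beta>" by (simp add: par_l_def alpha beta)
  then show "(of_real x - of_real (par_l \<alpha> \<sigma>)) * K z x
      = (\<alpha> * z + of_real \<sigma>) / \<beta> * K (z + \<beta>) x - ((\<alpha> - \<beta>) * z + of_real \<sigma>) / \<beta> * K z x"
    if "z \<in> D_set \<alpha> \<beta> \<sigma>" "x \<in> X_set \<alpha> \<beta>" for x z
    using K_shift[OF that(1), of x] that(2) gamma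
    by (simp add: X_set_def left_diff_distrib) (simp add: alpha beta)
  show "K 0 x = 1" if "x \<in> X_set \<alpha> \<beta>" for x
    using that gamma by (simp add: X_set_def K_0)
qed (simp_all add: K_L2 K_integral)

end

subsection \<open>The negative binomial distribution\<close>

locale neg_binomial =
  fixes \<alpha> \<beta> :: complex and \<sigma> a b \<eta> s q :: real
  assumes sigma: "\<sigma> > 0" and neg_binomial: "neg_binomial_case \<alpha> \<beta>"
    and a_def: "a = Re \<alpha>" and b_def: "b = Re \<beta>"
    and eta_def: "\<eta> = a * b" and s_def: "s = \<sigma> / \<eta>" and q_def: "q = b / a"
begin

lemma ab: "0 < b" "b < a" "0 < a" "\<alpha> = of_real a" "\<beta> = of_real b"
  using neg_binomial by (auto simp: neg_binomial_case_def a_def b_def complex_eq_iff)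

lemma eta_pos: "\<eta> > 0" and s_pos: "s > 0" and q: "0 < q" "q < 1"
  using ab sigma by (auto simp: eta_def s_def q_def)

lemma not_gamma: "\<not> gamma_case \<alpha> \<beta>"
  using ab by (auto simp: gamma_case_def)

lemma D_UNIV: "D_set \<alpha> \<beta> \<sigma> = UNIV"
  using ab by (simp add: D_set_def)

definition k :: "complex \<Rightarrow> nat \<Rightarrow> complex" where
  "k z n = of_real (1 - q) powr (z / of_real b)
     * (pochhammer (z / of_real b + of_real s) n / pochhammer (of_real s) n)"

text \<open>Off the support of the measure, the values of \<open>K\<close> are irrelevant.\<close>

definition K :: "complex \<Rightarrow> real \<Rightarrow> complex" where
  "K z x = k z (nat \<lfloor>x / (a - b)\<rfloor>)"

lemma K_point: "K z ((a - b) * real n) = k z n"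
  using ab by (simp add: K_def)

lemma pochhammer_s_pos: "pochhammer s n > 0"
  using s_pos by (rule pochhammer_pos)

lemma pochhammer_s_nz: "pochhammer (complex_of_real s) n \<noteq> 0"
  using pochhammer_s_pos[of n] by (simp add: pochhammer_of_real)

lemma k_formula:
  "k z n = (1 - \<beta> / \<alpha>) powr (z / \<beta>) * gen_fact (\<alpha> * z + of_real \<sigma>) (- of_real \<eta>) n
     / gen_fact (of_real \<sigma>) (- of_real \<eta>) n"
proof -
  have "(\<alpha> * z + of_real \<sigma>) / of_real \<eta> = z / of_real b + of_real s"
    using ab by (simp add: s_def eta_def field_simps)
  moreover have "1 - \<beta> / \<alpha> = of_real (1 - q)" by (simp add: ab q_def)
  moreover have "of_real \<sigma> / complex_of_real \<eta> = of_real s" by (simp add: s_def)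
  moreover have "complex_of_real \<eta> \<noteq> 0" using eta_pos by simp
  ultimately show ?thesis
    by (simp add: k_def gen_fact_eq_pochhammer ab(5))
qed

lemma k_0: "k 0 n = 1"
  using q pochhammer_s_nz by (simp add: k_def)

text \<open>Raising the Pochhammer parameter w + s by one trades the factor w + s for w + s + n,
  which is affine in n and hence in x = (a - b) n.\<close>

lemma k_shift:
  "of_real ((a - b) * real n - \<sigma> / a) * k z n
    = (\<alpha> * z + of_real \<sigma>) / \<beta> * k (z + \<beta>) n - ((\<alpha> - \<beta>) * z + of_real \<sigma>) / \<beta> * k z n"
proof -
  define w where "w = z / of_real b"
  have 1: "(z + \<beta>) / of_real b = w + 1" using ab by (simp add: w_def add_divide_distrib)
  have 2: "of_real (1 - q) powr (w + 1) = of_real (1 - q) powr w * of_real (1 - q)"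
    using q by (simp add: powr_add)
  have 3: "(w + of_real s) * pochhammer (w + 1 + of_real s) n = pochhammer (w + of_real s) n * (w + of_real s + of_nat n)"
    using pochhammer_rec[of "w + of_real s" n] pochhammer_Suc[of "w + of_real s" n]
    by (simp add: add.commute add.left_commute)
  have 4: "(\<alpha> * z + of_real \<sigma>) / \<beta> = of_real a * (w + of_real s)"
    using ab by (simp add: w_def s_def eta_def field_simps)
  have "(\<alpha> * z + of_real \<sigma>) / \<beta> * k (z + \<beta>) n
      = of_real a * of_real (1 - q) * (of_real (1 - q) powr w
        * (((w + of_real s) * pochhammer (w + 1 + of_real s) n) / pochhammer (of_real s) n))"
    unfolding k_def 1 2 4 by simp
  also have "\<dots> = of_real a * of_real (1 - q) * (w + of_real s + of_nat n) * k z n"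
    unfolding 3 k_def w_def[symmetric] by simp
  also have "of_real a * of_real (1 - q) * (w + of_real s + of_nat n)
      = of_real ((a - b) * real n - \<sigma> / a) + ((\<alpha> - \<beta>) * z + of_real \<sigma>) / \<beta>"
    using ab by (simp add: w_def s_def q_def eta_def field_simps)
  finally show ?thesis by (simp add: algebra_simps)
qed

abbreviation "wt \<equiv> neg_binomial_weight a b \<sigma>"

lemma weight_eq: "wt n = (1 - q) powr s * (q ^ n / fact n * pochhammer s n)"
  by (simp add: neg_binomial_weight_def Let_def q_def s_def eta_def)

lemma weight_pos: "wt n > 0"
  using q pochhammer_s_pos by (simp add: weight_eq)

lemma mu_eq:
  "mu \<alpha> \<beta> \<sigma> = distr (density (count_space UNIV) (\<lambda>n. ennreal (wt n)))
     (restrict_space borel (X_set \<alpha> \<beta>)) (\<lambda>n. (a - b) * real n)"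
  using not_gamma neg_binomial by (simp add: mu_def a_def b_def point_measure_def)

lemma X_eq: "X_set \<alpha> \<beta> = range (\<lambda>n. (a - b) * real n)"
  using not_gamma neg_binomial by (simp add: X_set_def a_def b_def)

lemma point_in_X: "(a - b) * real n \<in> X_set \<alpha> \<beta>"
  unfolding X_eq by (rule rangeI)

lemma point_measurable [measurable]:
  "(\<lambda>n. (a - b) * real n) \<in> measurable (density (count_space UNIV) (\<lambda>n. ennreal (wt n))) (restrict_space borel (X_set \<alpha> \<beta>))"
  by (rule measurable_restrict_space2) (auto simp: X_eq)

lemma K_measurable: "K z \<in> borel_measurable (mu \<alpha> \<beta> \<sigma>)"
proof -
  have "K z \<in> borel_measurable borel" unfolding K_def[abs_def] by measurable
  then show ?thesis
    unfolding mu_eq measurable_distr_eq1 by (rule measurable_restrict_space1)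
qed

lemma integrable_mu:
  fixes f :: "real \<Rightarrow> 'c :: {banach, second_countable_topology}"
  assumes f: "f \<in> borel_measurable (mu \<alpha> \<beta> \<sigma>)"
    and "summable (\<lambda>n. norm (wt n *\<^sub>R f ((a - b) * real n)))"
  shows "integrable (mu \<alpha> \<beta> \<sigma>) f"
    and "integral\<^sup>L (mu \<alpha> \<beta> \<sigma>) f = (\<Sum>n. wt n *\<^sub>R f ((a - b) * real n))"
proof -
  have [measurable]: "f \<in> borel_measurable (restrict_space borel (X_set \<alpha> \<beta>))"
    using f by (simp add: mu_eq)
  have int: "integrable (count_space UNIV) (\<lambda>n. wt n *\<^sub>R f ((a - b) * real n))"
    using assms(2) by (simp add: integrable_count_space_nat_iff)
  show "integrable (mu \<alpha> \<beta> \<sigma>) f"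
    unfolding mu_eq using int weight_pos
    by (subst integrable_distr_eq) (auto simp: integrable_density less_imp_le space_restrict_space point_in_X)
  show "integral\<^sup>L (mu \<alpha> \<beta> \<sigma>) f = (\<Sum>n. wt n *\<^sub>R f ((a - b) * real n))"
    unfolding mu_eq using integral_count_space_nat[OF int] weight_pos
    by (subst integral_distr) (auto simp: integral_density less_imp_le space_restrict_space point_in_X)
qed

text \<open>The factor \<open>pochhammer s n\<close> of the weight cancels the denominator of
  \<open>k\<close>, leaving the terms of a binomial series in q.\<close>

lemma weight_k:
  "wt n *\<^sub>R k z n = of_real (1 - q) powr (z / of_real b + of_real s)
     * (pochhammer (z / of_real b + of_real s) n / fact n * of_real q ^ n)"
proof -
  have "complex_of_real ((1 - q) powr s) = of_real (1 - q) powr of_real s"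
    using q by (intro powr_of_real[symmetric]) simp
  then show ?thesis
    using pochhammer_s_nz[of n]
    by (simp add: weight_eq k_def scaleR_conv_of_real powr_add pochhammer_of_real field_simps)
qed

text \<open>Ratio test: successive terms have ratio tending to q < 1 whatever z is.\<close>

lemma summable_weight_k_square:
  "summable (\<lambda>n. wt n * (cmod (k z n))\<^sup>2)"
proof -
  define u where "u = z / of_real b + of_real s"
  define f where "f n = q ^ n / (fact n * pochhammer s n) * (cmod (pochhammer u n))\<^sup>2" for n
  have f_Suc: "f (Suc n) = f n * (q * (cmod (u + of_nat n))\<^sup>2 / ((real n + 1) * (s + real n)))" for n
  proof -
    have 1: "cmod (pochhammer u (Suc n)) = cmod (pochhammer u n) * cmod (u + of_nat n)"
      by (simp add: pochhammer_Suc norm_mult)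
    have 2: "fact (Suc n) * pochhammer s (Suc n) = (fact n * pochhammer s n) * ((real n + 1) * (s + real n))"
      by (simp add: pochhammer_Suc algebra_simps)
    show ?thesis
      unfolding f_def 1 2 power_mult_distrib by simp
  qed
  have f_nonneg: "f n \<ge> 0" for n
    using q pochhammer_s_pos[of n] by (simp add: f_def)
  \<comment> \<open>Bounding \<bar>u + n\<bar> by B + n makes the ratio a real rational function of
    n; (1 + q) / 2 serves as a bound between its limit q and 1.\<close>
  define B where "B = cmod u"
  have "((\<lambda>n. q * (B + real n)\<^sup>2 / ((real n + 1) * (s + real n))) \<longlongrightarrow> q) sequentially"
    using q(1) s_pos by real_asymp
  then have "\<forall>\<^sub>F n in sequentially. q * (B + real n)\<^sup>2 / ((real n + 1) * (s + real n)) < (1 + q) / 2"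
    by (rule order_tendstoD) (use q in simp)
  then obtain N where N: "\<And>n. n \<ge> N \<Longrightarrow> q * (B + real n)\<^sup>2 / ((real n + 1) * (s + real n)) < (1 + q) / 2"
    by (auto simp: eventually_sequentially)
  have "summable f"
  proof (rule summable_ratio_test[of "(1 + q) / 2" N])
    fix n assume "n \<ge> N"
    have "cmod (u + of_nat n) \<le> B + real n"
      unfolding B_def using norm_triangle_ineq[of u "of_nat n"] by simp
    then have "q * (cmod (u + of_nat n))\<^sup>2 / ((real n + 1) * (s + real n))
        \<le> q * (B + real n)\<^sup>2 / ((real n + 1) * (s + real n))"
      using q s_pos by (intro divide_right_mono mult_left_mono power_mono) auto
    also have "\<dots> \<le> (1 + q) / 2" using N[OF \<open>n \<ge> N\<close>] by simp
    finally have "f (Suc n) \<le> f n * ((1 + q) / 2)"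
      unfolding f_Suc by (intro mult_left_mono f_nonneg)
    then show "norm (f (Suc n)) \<le> (1 + q) / 2 * norm (f n)"
      using f_nonneg by (simp add: mult.commute)
  qed (use q in simp)
  moreover have "wt n * (cmod (k z n))\<^sup>2
      = (1 - q) powr s * (cmod (of_real (1 - q) powr (z / of_real b)))\<^sup>2 * f n" for n
  proof -
    have "cmod (pochhammer (of_real s) n) = pochhammer s n"
      using pochhammer_s_pos[of n] by (simp add: pochhammer_of_real)
    then show ?thesis
      using pochhammer_s_pos[of n]
      by (simp add: weight_eq k_def f_def u_def norm_mult norm_divide power_mult_distrib power_divide
          power2_eq_square field_simps)
  qed
  ultimately show ?thesis by (simp add: summable_mult)
qed

lemma K_L2: "K z \<in> L2 (mu \<alpha> \<beta> \<sigma>)"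
proof -
  note [measurable] = K_measurable
  have "summable (\<lambda>n. norm (wt n *\<^sub>R (cmod (K z ((a - b) * real n)))\<^sup>2))"
    using summable_weight_k_square[of z] weight_pos by (simp add: K_point abs_mult less_imp_le)
  then have "integrable (mu \<alpha> \<beta> \<sigma>) (\<lambda>x. (cmod (K z x))\<^sup>2)"
    by (intro integrable_mu) auto
  then show ?thesis by (simp add: L2_def K_measurable)
qed

lemma K_integral: "(\<integral>x. K z x \<partial>mu \<alpha> \<beta> \<sigma>) = 1"
proof -
  define u where "u = z / of_real b + of_real s"
  let ?c = "complex_of_real (1 - q) powr u"
  have "(\<lambda>n. pochhammer u n / fact n * of_real q ^ n) sums (1 - of_real q) powr (- u)"
    using q by (intro pochhammer_powser) simp
  then have sums: "(\<lambda>n. wt n *\<^sub>R K z ((a - b) * real n)) sums (?c * of_real (1 - q) powr (- u))"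
    unfolding K_point weight_k u_def[symmetric] using sums_mult by fastforce
  have "summable (\<lambda>n. cmod ?c * (pochhammer (cmod u) n / fact n * q ^ n))"
    using q by (intro summable_mult summable_pochhammer_powser) simp
  then have "summable (\<lambda>n. norm (wt n *\<^sub>R K z ((a - b) * real n)))"
  proof (rule summable_comparison_test'[of _ 0])
    fix n
    show "norm (norm (wt n *\<^sub>R K z ((a - b) * real n))) \<le> cmod ?c * (pochhammer (cmod u) n / fact n * q ^ n)"
      unfolding K_point weight_k u_def[symmetric] norm_mult norm_divide norm_power using q
      by (auto intro!: mult_mono divide_right_mono norm_pochhammer_le
          intro: order_trans[OF norm_ge_zero norm_pochhammer_le])
  qed
  then have "(\<integral>x. K z x \<partial>mu \<alpha> \<beta> \<sigma>) = ?c * of_real (1 - q) powr (- u)"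
    using sums by (subst integrable_mu(2)) (auto simp: K_measurable sums_iff)
  also have "\<dots> = 1" using q by (simp add: powr_minus)
  finally show ?thesis .
qed

sublocale kernel_family \<alpha> \<beta> \<sigma> K
proof
  show "0 < \<sigma>" by (rule sigma)
  show "0 < par_eta \<alpha> \<beta>" "complex_of_real (par_eta \<alpha> \<beta>) = \<alpha> * \<beta>"
    "complex_of_real (par_lambda \<alpha> \<beta>) = \<alpha> + \<beta>"
    using ab by (simp_all add: par_eta_def par_lambda_def)
  show "(of_real x - of_real (par_l \<alpha> \<sigma>)) * K z x
      = (\<alpha> * z + of_real \<sigma>) / \<beta> * K (z + \<beta>) x - ((\<alpha> - \<beta>) * z + of_real \<sigma>) / \<beta> * K z x"
    if "x \<in> X_set \<alpha> \<beta>" for x z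
  proof -
    obtain n where x: "x = (a - b) * real n" using \<open>x \<in> X_set \<alpha> \<beta>\<close> by (auto simp: X_eq)
    have l: "par_l \<alpha> \<sigma> = \<sigma> / a" by (simp add: par_l_def ab)
    show ?thesis unfolding x l K_point using k_shift[of n z] by simp
  qed
  show "K 0 x = 1" if "x \<in> X_set \<alpha> \<beta>" for x
    using that by (auto simp: X_eq K_point k_0)
qed (simp_all add: K_L2 K_integral)

text \<open>Every atom has positive weight, so an almost sure property holds at all of them. This
  pins down the chosen representative of the kernel on the whole support.\<close>

lemma AE_pointwise:
  assumes "AE x in mu \<alpha> \<beta> \<sigma>. P x"
  shows "P ((a - b) * real n)"
proof -
  have "AE n in density (count_space UNIV) (\<lambda>n. ennreal (wt n)). P ((a - b) * real n)"
    using AE_distrD[OF point_measurable assms[unfolded mu_eq]] .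
  then show ?thesis
    using weight_pos by (simp add: AE_density AE_count_space)
qed

end

subsection \<open>The theorem\<close>

theorem lemma3p8:
  fixes \<alpha> \<beta> :: complex and \<sigma> \<eta> :: real
    and S :: "(real \<Rightarrow> complex) \<Rightarrow> complex \<Rightarrow> complex"
  assumes "\<sigma> > 0"
    and "gamma_case \<alpha> \<beta> \<or> neg_binomial_case \<alpha> \<beta> \<or> meixner_case \<alpha> \<beta>"
    and "\<eta> = par_eta \<alpha> \<beta>"
    and "unitary_L2_F \<alpha> \<beta> \<sigma> S"
    and "\<forall>n. \<forall>z\<in>D_set \<alpha> \<beta> \<sigma>. S (s_fun \<alpha> \<beta> \<sigma> n) z = gen_fact z \<beta> n"
  shows "(\<forall>z\<in>D_set \<alpha> \<beta> \<sigma>.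
            L2_sums (mu \<alpha> \<beta> \<sigma>) (E_term \<alpha> \<beta> \<sigma> z) (\<lambda>x. E_kernel \<alpha> \<beta> \<sigma> x z) \<and>
            (\<lambda>x. E_kernel \<alpha> \<beta> \<sigma> x z) \<in> L2 (mu \<alpha> \<beta> \<sigma>) \<and>
            (\<forall>f\<in>L2 (mu \<alpha> \<beta> \<sigma>).
               integrable (mu \<alpha> \<beta> \<sigma>) (\<lambda>x. f x * E_kernel \<alpha> \<beta> \<sigma> x z) \<and>
               S f z = (\<integral>x. f x * E_kernel \<alpha> \<beta> \<sigma> x z \<partial>mu \<alpha> \<beta> \<sigma>))) \<and>
         (gamma_case \<alpha> \<beta> \<longrightarrow>
            (\<forall>z\<in>D_set \<alpha> \<beta> \<sigma>. AE x in mu \<alpha> \<beta> \<sigma>.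
               E_kernel \<alpha> \<beta> \<sigma> x z =
                 Gamma (of_real \<sigma> / \<alpha>\<^sup>2) / Gamma ((\<alpha> * z + of_real \<sigma>) / \<alpha>\<^sup>2)
                 * (of_real x / \<alpha>) powr (z / \<alpha>))) \<and>
         (neg_binomial_case \<alpha> \<beta> \<longrightarrow>
            (\<forall>z. \<forall>n::nat.
               E_kernel \<alpha> \<beta> \<sigma> ((Re \<alpha> - Re \<beta>) * real n) z =
                 (1 - \<beta> / \<alpha>) powr (z / \<beta>)
                 * gen_fact (\<alpha> * z + of_real \<sigma>) (- of_real \<eta>) n
                 / gen_fact (of_real \<sigma>) (- of_real \<eta>) n)) \<and>
         (meixner_case \<alpha> \<beta> \<longrightarrow>
            (\<forall>z\<in>D_set \<alpha> \<beta> \<sigma>. AE x in mu \<alpha> \<beta> \<sigma>.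
               E_kernel \<alpha> \<beta> \<sigma> x z =
                 of_real (2 * cos (pi / 2 - Arg \<alpha>)) powr (\<alpha> * z / of_real \<eta>)
                 * (Gamma (of_real (\<sigma> / \<eta>)) / Gamma ((of_real \<sigma> + \<alpha> * z) / of_real \<eta>))
                 * exp (\<i> * of_real (pi / 2 - Arg \<alpha>) * \<alpha> * z / of_real \<eta>)
                 * (Gamma (- (\<i> * of_real x / of_real (2 * Im \<alpha>))
                           - \<i> * of_real \<sigma> * \<alpha> / of_real (2 * \<eta> * Im \<alpha>)
                           + \<alpha> * z / of_real \<eta>)
                    / Gamma (- (\<i> * of_real x / of_real (2 * Im \<alpha>))
                             - \<i> * of_real \<sigma> * \<alpha> / of_real (2 * \<eta> * Im \<alpha>)))))"
proof -
  note sigma = assms(1) and cases = assms(2) and eta = assms(3) and unitary = assms(4)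
  have S_s: "S (s_fun \<alpha> \<beta> \<sigma> n) z = gen_fact z \<beta> n" if "z \<in> D_set \<alpha> \<beta> \<sigma>" for z n
    using assms(5) that by blast
  consider (gamma) "gamma_case \<alpha> \<beta>" | (neg_binomial) "neg_binomial_case \<alpha> \<beta>" | (meixner) "meixner_case \<alpha> \<beta>"
    using cases by blast
  then show ?thesis
  proof cases
    case gamma
    interpret gamma_weight \<alpha> \<beta> \<sigma> "Re \<alpha>" "\<sigma> / (Re \<alpha>)\<^sup>2"
      by unfold_locales (use sigma gamma in simp_all)
    interpret kernel_unitary \<alpha> \<beta> \<sigma> K S
      by unfold_locales (use unitary S_s in simp_all)
    \<comment> \<open>The cases exclude one another, so the formulas of the other two hold
      vacuously.\<close>
    have "\<not> neg_binomial_case \<alpha> \<beta>" "\<not> meixner_case \<alpha> \<beta>"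
      using gamma by (auto simp: gamma_case_def neg_binomial_case_def meixner_case_def)
    then show ?thesis
      using kernel_representation E_kernel_AE_eq[unfolded K_formula] by blast
  next
    case neg_binomial
    interpret neg_binomial \<alpha> \<beta> \<sigma> "Re \<alpha>" "Re \<beta>" \<eta> "\<sigma> / \<eta>" "Re \<beta> / Re \<alpha>"
      by unfold_locales (use sigma neg_binomial eta in \<open>auto simp: par_eta_def neg_binomial_case_def\<close>)
    interpret kernel_unitary \<alpha> \<beta> \<sigma> K S
      by unfold_locales (use unitary S_s in simp_all)
    have "\<not> gamma_case \<alpha> \<beta>" "\<not> meixner_case \<alpha> \<beta>"
      using neg_binomial by (auto simp: gamma_case_def neg_binomial_case_def meixner_case_def)
    moreover have "E_kernel \<alpha> \<beta> \<sigma> ((Re \<alpha> - Re \<beta>) * real n) z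
        = (1 - \<beta> / \<alpha>) powr (z / \<beta>) * gen_fact (\<alpha> * z + of_real \<sigma>) (- of_real \<eta>) n
          / gen_fact (of_real \<sigma>) (- of_real \<eta>) n" for n z
      using AE_pointwise[OF E_kernel_AE_eq[of z], of n] D_UNIV by (simp add: K_point k_formula)
    ultimately show ?thesis
      using kernel_representation by blast
  next
    case meixner
    interpret meixner \<alpha> \<beta> \<sigma> \<eta> "pi / 2 - Arg \<alpha>" "\<sigma> / \<eta>" "2 * Im \<alpha>" "\<sigma> * Re \<alpha> / (\<eta> * (2 * Im \<alpha>))"
      by unfold_locales (use sigma meixner eta in simp_all)
    interpret kernel_unitary \<alpha> \<beta> \<sigma> K S
      by unfold_locales (use unitary S_s in simp_all)
    show ?thesis
      using not_cases kernel_representation E_kernel_AE_eq[unfolded K_formula] by blast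
  qed
qed

end
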